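(* Let $\mathcal A=T(V)/(R)$ be a quadratic algebra with characteristic variety $E$ and automorphism $\sigma$ of $E$, let $C$ be a component of $E\times E$ globally invariant under $\tilde\sigma(Z,Z')=(\sigma(Z),\sigma^{-1}(Z'))$, and let $Q\in S^2(V)$ be central on $C$ and not identically zero on $C$. (i) The equality $$\sqrt2\,\rho(Y)=\frac{Y(Z)}{L(Z)}\,W_L+W'_{L'}\,\frac{Y(Z')}{L'(Z')}\qquad(Y\in V)$$ defines an algebra homomorphism $\rho:\mathcal A\to C_Q$. (ii) If $\sigma^4\neq \mathbb 1$, then $\rho(Q)=1$, where $Q$ is viewed as an element of $T(V)/(R)$.
   Context: $V$ is a finite-dimensional complex vector space, $R\subset V\otimes V$ a subspace, $(R)$ the two-sided ideal it generates in the tensor algebra $T(V)$. Elements of $V\otimes V$ are viewed as bilinear forms on $V^*$, elements of $S^2(V)$ as symmetric bilinear forms on $V^*$. Let $\Gamma\subset P(V^* )\times P(V^* )$ be the set of pairs $(Z,Z')$ with $\omega(Z,Z')=0$ for all $\omega\in R$; it is assumed that both projections of $\Gamma$ coincide with a subvariety $E\subset P(V^* )$ (the characteristic variety) and that $\Gamma$ is the graph of an automorphism $\sigma$ of $E$. $Q\in S^2(V)$ is called central on a component $C$ of $E\times E$ if for all $(Z,Z')\in C$ and $\omega\in R$ $$\omega(Z,Z')\,Q(\sigma(Z'),\sigma^{-1}(Z))+Q(Z,Z')\,\omega(\sigma(Z'),\sigma^{-1}(Z))=0$$ (for any choice of representatives in $V^*$ of $Z,Z',\sigma(Z'),\sigma^{-1}(Z)$).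 The algebra $C_Q$ is the generalised crossed product of the ring $\mathcal R$ of meromorphic functions on $C$ by $\tilde\sigma$: choose $L,L'\in V$ such that $L(Z)L'(Z')$ does not vanish identically on $C$; $C_Q$ is generated by $\mathcal R$ and two elements $W_L,W'_{L'}$ with $$W_Lf=(f\circ\tilde\sigma)W_L,\quad W'_{L'}f=(f\circ\tilde\sigma^{-1})W'_{L'}\quad(f\in\mathcal R),$$ $$W_LW'_{L'}=\pi(Z,Z'),\quad W'_{L'}W_L=\pi(\sigma^{-1}(Z),\sigma(Z')),\quad \pi(Z,Z')=\frac{L(Z)L'(Z')}{Q(Z,Z')}.$$ The algebra and the formula for $\rho$ do not depend on $L,L'$ through the identifications $W_{L_2}=\frac{L_2(Z)}{L_1(Z)}W_{L_1}$, $W'_{L_2'}=W'_{L_1'}\frac{L_2'(Z')}{L_1'(Z')}$.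
   Formalization: In (ii), C is assumed to be K×K and σ⁴ to be different from the identity on K; for reducible E the condition σ⁴≠1 on E alone does not suffice. "Component" means irreducible component, and meromorphic functions are taken as quotients of bihomogeneous polynomials. *)

theory Defs
  imports "HOL-Analysis.Analysis" "HOL-Algebra.QuotRing" "HOL-Algebra.Module"
begin

section \<open>Linear and bilinear forms, projective space\<close>

text \<open>
  A basis of \<open>V\<close> is fixed, indexed by a finite type \<open>'n\<close>. With the dual basis on \<open>V*\<close>, a vector
  \<open>Y\<close> in \<open>V\<close> is a coefficient vector acting on \<open>V*\<close> as a linear form, and an element of
  \<open>V \<otimes> V\<close> is a vector of coefficients indexed by \<open>'n \<times> 'n\<close>, acting on \<open>V* \<times> V*\<close> as a bilinear form.
\<close>

type_synonym 'n dual = "complex ^ 'n"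
type_synonym 'n tensor2 = "complex ^ ('n \<times> 'n)"

definition lin :: "complex ^ 'n \<Rightarrow> 'n::finite dual \<Rightarrow> complex" where
  "lin Y z = (\<Sum>i\<in>UNIV. Y $ i * z $ i)"

definition bil :: "'n tensor2 \<Rightarrow> 'n::finite dual \<Rightarrow> 'n dual \<Rightarrow> complex" where
  "bil \<omega> z z' = (\<Sum>i\<in>UNIV. \<Sum>j\<in>UNIV. \<omega> $ (i, j) * z $ i * z' $ j)"

definition symmetric_tensor :: "'n::finite tensor2 \<Rightarrow> bool" where
  "symmetric_tensor Q \<longleftrightarrow> (\<forall>i j. Q $ (i, j) = Q $ (j, i))"

text \<open>Points of \<open>P(V*)\<close> are the lines through the origin of \<open>V*\<close>; the representatives of a point are
  its nonzero vectors.\<close>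

typedef 'n proj = "{l :: ('n::finite) dual set. \<exists>v. v \<noteq> 0 \<and> l = range (\<lambda>c. c *s v)}"
proof -
  have "(\<chi> i. (1 :: complex)) \<noteq> (0 :: 'n dual)"
    by (simp add: vec_eq_iff)
  then show ?thesis by blast
qed

definition reps :: "'n::finite proj \<Rightarrow> 'n dual set" where
  "reps Z = Rep_proj Z - {0}"

section \<open>Zariski topology\<close>

definition exponents :: "nat \<Rightarrow> ('n::finite \<Rightarrow> nat) set" where
  "exponents d = {m. (\<Sum>i\<in>UNIV. m i) = d}"

definition form :: "nat \<Rightarrow> ('n::finite dual \<Rightarrow> complex) \<Rightarrow> bool" where
  "form d p \<longleftrightarrow> (\<exists>a. \<forall>z. p z = (\<Sum>m\<in>exponents d. a m * (\<Prod>i\<in>UNIV. z $ i ^ m i)))"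

definition biform :: "nat \<Rightarrow> nat \<Rightarrow> ('n::finite dual \<Rightarrow> 'n dual \<Rightarrow> complex) \<Rightarrow> bool" where
  "biform d e p \<longleftrightarrow> (\<exists>a. \<forall>z z'. p z z' =
     (\<Sum>m\<in>exponents d. \<Sum>m'\<in>exponents e.
        a m m' * (\<Prod>i\<in>UNIV. z $ i ^ m i) * (\<Prod>i\<in>UNIV. z' $ i ^ m' i)))"

definition projective_variety :: "'n::finite proj set \<Rightarrow> bool" where
  "projective_variety E \<longleftrightarrow> (\<exists>F. (\<forall>p\<in>F. \<exists>d. form d p) \<and>
     E = {Z. \<forall>p\<in>F. \<forall>z\<in>reps Z. p z = 0})"

definition vanishes_on :: "('n::finite proj \<times> 'n proj) set \<Rightarrow> ('n dual \<Rightarrow> 'n dual \<Rightarrow> complex) \<Rightarrow> bool"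
  where "vanishes_on C p \<longleftrightarrow> (\<forall>(Z, Z')\<in>C. \<forall>z\<in>reps Z. \<forall>z'\<in>reps Z'. p z z' = 0)"

definition biclosed :: "('n::finite proj \<times> 'n proj) set \<Rightarrow> bool" where
  "biclosed A \<longleftrightarrow> (\<exists>F. (\<forall>p\<in>F. \<exists>d e. biform d e p) \<and> A = {x. \<forall>p\<in>F. vanishes_on {x} p})"

definition irreducible_set :: "('n::finite proj \<times> 'n proj) set \<Rightarrow> bool" where
  "irreducible_set S \<longleftrightarrow> S \<noteq> {} \<and>
     (\<forall>A B. biclosed A \<longrightarrow> biclosed B \<longrightarrow> S \<subseteq> A \<union> B \<longrightarrow> S \<subseteq> A \<or> S \<subseteq> B)"

text \<open>Components are the irreducible components, that is the maximal irreducible subsets.\<close>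

definition component_of :: "('n::finite proj \<times> 'n proj) set \<Rightarrow> ('n proj \<times> 'n proj) set \<Rightarrow> bool" where
  "component_of X C \<longleftrightarrow> C \<subseteq> X \<and> irreducible_set C \<and>
     (\<forall>D. irreducible_set D \<longrightarrow> C \<subseteq> D \<longrightarrow> D \<subseteq> X \<longrightarrow> D = C)"

text \<open>A morphism from \<open>E\<close> to projective space is given, near every point of \<open>E\<close>, by forms of one
  common degree without common zero.\<close>

definition regular_map_on :: "'n::finite proj set \<Rightarrow> ('n proj \<Rightarrow> 'n proj) \<Rightarrow> bool" where
  "regular_map_on E \<phi> \<longleftrightarrow> (\<forall>Z\<^sub>0\<in>E. \<exists>d F. (\<forall>i. form d (\<lambda>z. F z $ i)) \<and>
     (\<forall>z\<in>reps Z\<^sub>0. F z \<noteq> 0) \<and> (\<forall>Z\<in>E. \<forall>z\<in>reps Z. F z \<noteq> 0 \<longrightarrow> F z \<in> reps (\<phi> Z)))"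

definition variety_automorphism :: "'n::finite proj set \<Rightarrow> ('n proj \<Rightarrow> 'n proj) \<Rightarrow> bool" where
  "variety_automorphism E \<sigma> \<longleftrightarrow>
     bij_betw \<sigma> E E \<and> regular_map_on E \<sigma> \<and> regular_map_on E (inv_into E \<sigma>)"

section \<open>Characteristic variety and central quadratic forms\<close>

definition \<Gamma> :: "'n::finite tensor2 set \<Rightarrow> ('n proj \<times> 'n proj) set" where
  "\<Gamma> R = {x. \<forall>\<omega>\<in>R. vanishes_on {x} (bil \<omega>)}"

definition characteristic_variety ::
    "'n::finite tensor2 set \<Rightarrow> 'n proj set \<Rightarrow> ('n proj \<Rightarrow> 'n proj) \<Rightarrow> bool" where
  "characteristic_variety R E \<sigma> \<longleftrightarrow> projective_variety E \<and> fst ` \<Gamma> R = E \<and> snd ` \<Gamma> R = E \<and>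
     variety_automorphism E \<sigma> \<and> \<Gamma> R = (\<lambda>Z. (Z, \<sigma> Z)) ` E"

definition twist ::
    "'n::finite proj set \<Rightarrow> ('n proj \<Rightarrow> 'n proj) \<Rightarrow> 'n proj \<times> 'n proj \<Rightarrow> 'n proj \<times> 'n proj" where
  "twist E \<sigma> = (\<lambda>(Z, Z'). (\<sigma> Z, inv_into E \<sigma> Z'))"

definition twist_inv ::
    "'n::finite proj set \<Rightarrow> ('n proj \<Rightarrow> 'n proj) \<Rightarrow> 'n proj \<times> 'n proj \<Rightarrow> 'n proj \<times> 'n proj" where
  "twist_inv E \<sigma> = (\<lambda>(Z, Z'). (inv_into E \<sigma> Z, \<sigma> Z'))"

definition central_on ::
    "'n::finite tensor2 set \<Rightarrow> 'n proj set \<Rightarrow> ('n proj \<Rightarrow> 'n proj) \<Rightarrow> ('n proj \<times> 'n proj) set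
      \<Rightarrow> 'n tensor2 \<Rightarrow> bool" where
  "central_on R E \<sigma> C Q \<longleftrightarrow> (\<forall>(Z, Z')\<in>C. \<forall>\<omega>\<in>R.
     \<forall>z\<in>reps Z. \<forall>z'\<in>reps Z'. \<forall>s\<in>reps (\<sigma> Z'). \<forall>t\<in>reps (inv_into E \<sigma> Z).
       bil \<omega> z z' * bil Q s t + bil Q z z' * bil \<omega> s t = 0)"

section \<open>Meromorphic functions on a component\<close>

text \<open>
  For an irreducible projective variety, meromorphic functions are taken in the algebraic sense: they
  are locally (hence, by irreducibility, globally) quotients of bihomogeneous polynomials of equal
  bidegree. A representative is a function on points which is such a quotient wherever the denominator
  does not vanish; its other values, and its values outside \<open>C\<close>, are arbitrary, and two representatives
  are identified if they agree on a nonempty open subset of \<open>C\<close>.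
\<close>

definition mero_rep :: "('n::finite proj \<times> 'n proj) set \<Rightarrow> ('n proj \<times> 'n proj \<Rightarrow> complex) set" where
  "mero_rep C = {f. \<exists>d e p q. biform d e p \<and> biform d e q \<and> \<not> vanishes_on C q \<and>
     (\<forall>(Z, Z')\<in>C. \<forall>z\<in>reps Z. \<forall>z'\<in>reps Z'. q z z' \<noteq> 0 \<longrightarrow> f (Z, Z') = p z z' / q z z')}"

definition mero_rep_ring ::
    "('n::finite proj \<times> 'n proj) set \<Rightarrow> ('n proj \<times> 'n proj \<Rightarrow> complex) ring" where
  "mero_rep_ring C = \<lparr>carrier = mero_rep C, mult = (\<lambda>f g x. f x * g x), one = (\<lambda>_. 1),
     zero = (\<lambda>_. 0), add = (\<lambda>f g x. f x + g x)\<rparr>"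

definition mero_null :: "('n::finite proj \<times> 'n proj) set \<Rightarrow> ('n proj \<times> 'n proj \<Rightarrow> complex) set" where
  "mero_null C = {f \<in> mero_rep C. \<exists>d e q. biform d e q \<and> \<not> vanishes_on C q \<and>
     (\<forall>x\<in>C. \<not> vanishes_on {x} q \<longrightarrow> f x = 0)}"

definition mero_ring :: "('n::finite proj \<times> 'n proj) set \<Rightarrow> ('n proj \<times> 'n proj \<Rightarrow> complex) set ring"
  where "mero_ring C = mero_rep_ring C Quot mero_null C"

definition mero_class ::
    "('n::finite proj \<times> 'n proj) set \<Rightarrow> ('n proj \<times> 'n proj \<Rightarrow> complex)
      \<Rightarrow> ('n proj \<times> 'n proj \<Rightarrow> complex) set" where
  "mero_class C f = mero_null C +>\<^bsub>mero_rep_ring C\<^esub> f"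

text \<open>The quotient of two bihomogeneous functions of the same bidegree does not depend on the chosen
  representatives.\<close>

definition ratio ::
    "('n::finite dual \<Rightarrow> 'n dual \<Rightarrow> complex) \<Rightarrow> ('n dual \<Rightarrow> 'n dual \<Rightarrow> complex)
      \<Rightarrow> 'n proj \<times> 'n proj \<Rightarrow> complex" where
  "ratio p q = (\<lambda>(Z, Z'). let z = (SOME z. z \<in> reps Z); z' = (SOME z'. z' \<in> reps Z')
     in p z z' / q z z')"

section \<open>Free algebras and their quotients\<close>

text \<open>Elements of the free unital complex algebra on \<open>G\<close> are finitely supported functions on words
  over \<open>G\<close>. All complex algebras below are records carrying a ring structure and a scalar
  multiplication.\<close>

definition free_algebra :: "'g set \<Rightarrow> (complex, 'g list \<Rightarrow> complex) module" where
  "free_algebra G = \<lparr>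
     carrier = {f. finite {w. f w \<noteq> 0} \<and> (\<forall>w. f w \<noteq> 0 \<longrightarrow> set w \<subseteq> G)},
     mult = (\<lambda>f g w. \<Sum>k\<le>length w. f (take k w) * g (drop k w)),
     one = (\<lambda>w. if w = [] then 1 else 0),
     zero = (\<lambda>w. 0),
     add = (\<lambda>f g w. f w + g w),
     smult = (\<lambda>c f w. c * f w)\<rparr>"

definition free_gen :: "'g \<Rightarrow> 'g list \<Rightarrow> complex" where
  "free_gen g = (\<lambda>w. if w = [g] then 1 else 0)"

definition quot_algebra :: "(complex, 'a) module \<Rightarrow> 'a set \<Rightarrow> (complex, 'a set) module" where
  "quot_algebra A I = \<lparr>
     carrier = carrier (A Quot I), mult = mult (A Quot I), one = one (A Quot I),
     zero = zero (A Quot I), add = add (A Quot I),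
     smult = (\<lambda>c X. \<Union>x\<in>X. I +>\<^bsub>A\<^esub> (c \<odot>\<^bsub>A\<^esub> x))\<rparr>"

definition algebra_hom :: "(complex, 'a) module \<Rightarrow> (complex, 'b) module \<Rightarrow> ('a \<Rightarrow> 'b) set" where
  "algebra_hom A B = {h \<in> ring_hom A B.
     \<forall>c. \<forall>x\<in>carrier A. h (c \<odot>\<^bsub>A\<^esub> x) = c \<odot>\<^bsub>B\<^esub> h x}"

section \<open>The quadratic algebra\<close>

text \<open>In the chosen basis \<open>T(V)\<close> is the free algebra on \<open>'n\<close>: the degree \<open>k\<close> tensors are the functions
  supported on words of length \<open>k\<close>.\<close>

abbreviation tensor_algebra :: "(complex, 'n::finite list \<Rightarrow> complex) module" where
  "tensor_algebra \<equiv> free_algebra UNIV"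

definition tensor1_in :: "complex ^ 'n \<Rightarrow> 'n::finite list \<Rightarrow> complex" where
  "tensor1_in Y w = (case w of [i] \<Rightarrow> Y $ i | _ \<Rightarrow> 0)"

definition tensor2_in :: "'n tensor2 \<Rightarrow> 'n::finite list \<Rightarrow> complex" where
  "tensor2_in \<omega> w = (case w of [i, j] \<Rightarrow> \<omega> $ (i, j) | _ \<Rightarrow> 0)"

definition quadratic_ideal :: "'n::finite tensor2 set \<Rightarrow> ('n list \<Rightarrow> complex) set" where
  "quadratic_ideal R = Idl\<^bsub>tensor_algebra\<^esub> (tensor2_in ` R)"

definition quadratic_algebra ::
    "'n::finite tensor2 set \<Rightarrow> (complex, ('n list \<Rightarrow> complex) set) module" where
  "quadratic_algebra R = quot_algebra tensor_algebra (quadratic_ideal R)"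

definition quadratic_class ::
    "'n::finite tensor2 set \<Rightarrow> ('n list \<Rightarrow> complex) \<Rightarrow> ('n list \<Rightarrow> complex) set" where
  "quadratic_class R t = quadratic_ideal R +>\<^bsub>tensor_algebra\<^esub> t"

section \<open>The generalised crossed product\<close>

text \<open>The algebra \<open>C\<^sub>Q\<close> is presented by generators (one for each meromorphic function, together with
  \<open>W\<^sub>L\<close> and \<open>W'\<^sub>L\<^sub>'\<close>) and relations. The first three families of relators say that the meromorphic
  functions are mapped by a homomorphism of complex algebras.\<close>

datatype 'a cq_gen = Fun 'a | W | W'

definition cq_pi :: "'n tensor2 \<Rightarrow> complex ^ 'n \<Rightarrow> complex ^ 'n \<Rightarrow> 'n::finite proj \<times> 'n proj \<Rightarrow> complex"
  where "cq_pi Q L L' = ratio (\<lambda>z z'. lin L z * lin L' z') (bil Q)"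

definition cq_free ::
    "('n::finite proj \<times> 'n proj) set
      \<Rightarrow> (complex, ('n proj \<times> 'n proj \<Rightarrow> complex) set cq_gen list \<Rightarrow> complex) module" where
  "cq_free C = free_algebra (insert W (insert W' (Fun ` carrier (mero_ring C))))"

definition cq_relators ::
    "'n::finite proj set \<Rightarrow> ('n proj \<Rightarrow> 'n proj) \<Rightarrow> ('n proj \<times> 'n proj) set \<Rightarrow> 'n tensor2
      \<Rightarrow> complex ^ 'n \<Rightarrow> complex ^ 'n
      \<Rightarrow> (('n proj \<times> 'n proj \<Rightarrow> complex) set cq_gen list \<Rightarrow> complex) set" where
  "cq_relators E \<sigma> C Q L L' =
    (let F = cq_free C; M = mero_ring C; \<gamma> = (\<lambda>r. free_gen (Fun r)); m = mero_class C;
         w = free_gen W; w' = free_gen W'; \<pi> = cq_pi Q L L'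
     in {\<gamma> (r \<oplus>\<^bsub>M\<^esub> s) \<ominus>\<^bsub>F\<^esub> (\<gamma> r \<oplus>\<^bsub>F\<^esub> \<gamma> s) | r s. r \<in> carrier M \<and> s \<in> carrier M}
      \<union> {\<gamma> (r \<otimes>\<^bsub>M\<^esub> s) \<ominus>\<^bsub>F\<^esub> (\<gamma> r \<otimes>\<^bsub>F\<^esub> \<gamma> s) | r s. r \<in> carrier M \<and> s \<in> carrier M}
      \<union> {\<gamma> (m (\<lambda>_. c)) \<ominus>\<^bsub>F\<^esub> (c \<odot>\<^bsub>F\<^esub> \<one>\<^bsub>F\<^esub>) | c. True}
      \<union> {(w \<otimes>\<^bsub>F\<^esub> \<gamma> (m f)) \<ominus>\<^bsub>F\<^esub> (\<gamma> (m (f \<circ> twist E \<sigma>)) \<otimes>\<^bsub>F\<^esub> w) | f. f \<in> mero_rep C}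
      \<union> {(w' \<otimes>\<^bsub>F\<^esub> \<gamma> (m f)) \<ominus>\<^bsub>F\<^esub> (\<gamma> (m (f \<circ> twist_inv E \<sigma>)) \<otimes>\<^bsub>F\<^esub> w') | f. f \<in> mero_rep C}
      \<union> {(w \<otimes>\<^bsub>F\<^esub> w') \<ominus>\<^bsub>F\<^esub> \<gamma> (m \<pi>),
         (w' \<otimes>\<^bsub>F\<^esub> w) \<ominus>\<^bsub>F\<^esub> \<gamma> (m (\<lambda>(Z, Z'). \<pi> (inv_into E \<sigma> Z, \<sigma> Z')))})"

definition cq_ideal ::
    "'n::finite proj set \<Rightarrow> ('n proj \<Rightarrow> 'n proj) \<Rightarrow> ('n proj \<times> 'n proj) set \<Rightarrow> 'n tensor2
      \<Rightarrow> complex ^ 'n \<Rightarrow> complex ^ 'n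
      \<Rightarrow> (('n proj \<times> 'n proj \<Rightarrow> complex) set cq_gen list \<Rightarrow> complex) set" where
  "cq_ideal E \<sigma> C Q L L' = Idl\<^bsub>cq_free C\<^esub> (cq_relators E \<sigma> C Q L L')"

definition CQ ::
    "'n::finite proj set \<Rightarrow> ('n proj \<Rightarrow> 'n proj) \<Rightarrow> ('n proj \<times> 'n proj) set \<Rightarrow> 'n tensor2
      \<Rightarrow> complex ^ 'n \<Rightarrow> complex ^ 'n
      \<Rightarrow> (complex, (('n proj \<times> 'n proj \<Rightarrow> complex) set cq_gen list \<Rightarrow> complex) set) module" where
  "CQ E \<sigma> C Q L L' = quot_algebra (cq_free C) (cq_ideal E \<sigma> C Q L L')"

definition cq_elem ::
    "'n::finite proj set \<Rightarrow> ('n proj \<Rightarrow> 'n proj) \<Rightarrow> ('n proj \<times> 'n proj) set \<Rightarrow> 'n tensor2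
      \<Rightarrow> complex ^ 'n \<Rightarrow> complex ^ 'n \<Rightarrow> ('n proj \<times> 'n proj \<Rightarrow> complex) set cq_gen
      \<Rightarrow> (('n proj \<times> 'n proj \<Rightarrow> complex) set cq_gen list \<Rightarrow> complex) set" where
  "cq_elem E \<sigma> C Q L L' g = cq_ideal E \<sigma> C Q L L' +>\<^bsub>cq_free C\<^esub> free_gen g"

text \<open>The defining formula of \<open>\<rho>\<close> on the generators \<open>Y \<in> V\<close>.\<close>

definition rho_formula ::
    "'n::finite tensor2 set \<Rightarrow> 'n proj set \<Rightarrow> ('n proj \<Rightarrow> 'n proj) \<Rightarrow> ('n proj \<times> 'n proj) set
      \<Rightarrow> 'n tensor2 \<Rightarrow> complex ^ 'n \<Rightarrow> complex ^ 'n
      \<Rightarrow> (('n list \<Rightarrow> complex) set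
            \<Rightarrow> (('n proj \<times> 'n proj \<Rightarrow> complex) set cq_gen list \<Rightarrow> complex) set) \<Rightarrow> bool" where
  "rho_formula R E \<sigma> C Q L L' \<rho> \<longleftrightarrow>
    (let B = CQ E \<sigma> C Q L L'; el = cq_elem E \<sigma> C Q L L' in
     \<forall>Y. complex_of_real (sqrt 2) \<odot>\<^bsub>B\<^esub> \<rho> (quadratic_class R (tensor1_in Y)) =
        (el (Fun (mero_class C (ratio (\<lambda>z z'. lin Y z) (\<lambda>z z'. lin L z)))) \<otimes>\<^bsub>B\<^esub> el W)
        \<oplus>\<^bsub>B\<^esub> (el W' \<otimes>\<^bsub>B\<^esub> el (Fun (mero_class C (ratio (\<lambda>z z'. lin Y z') (\<lambda>z z'. lin L' z'))))))"

end

(*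
  Write u = W_L and u' = W'_{L'}. Expanding 2 rho(Y) rho(Y') and moving the meromorphic functions
  past u and u', an element omega of V \<otimes> V is sent to half of f u^2 + g + u'^2 h, where f is
  omega(Z, sigma Z), h is omega(sigma^-1 Z', Z') and g is
  omega(Z, Z')/Q(Z, Z') + omega(sigma Z', sigma^-1 Z)/Q(sigma Z', sigma^-1 Z), up to the linear
  forms L, L' in the denominators. For omega in R the first two vanish because (Z, sigma Z) lies on
  Gamma, and g vanishes because Q is central, so rho is well defined. For omega = Q one has g = 2,
  while centrality at (Z, sigma Z) forces Q(Z, sigma Z) = 0 wherever sigma^4 Z \<noteq> Z; as this
  inequality is an open condition, f and h are then zero as meromorphic functions.
*)
theory Submission
  imports Defs
begin

section \<open>Bihomogeneous polynomials\<close>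

text \<open>A meromorphic function is known only up to its values on a proper closed subset of
  \<open>C\<close>, so identities of coefficients are proved on some nonempty open subset.
  Irreducibility lets two such subsets be intersected, and surjectivity of the twist on
  \<open>C\<close> lets them be pulled back. Morphisms are given by forms only locally, but one
  local expression near one point of \<open>C\<close> already represents the whole pulled-back
  function. For the second claim the open condition concerns a single point \<open>Z\<close>,
  whereas open sets are available on pairs. The twist closes the gap: applied twice it sends
  \<open>(Z, Z')\<close> to \<open>(\<sigma>^2 Z, \<sigma>^-2 Z')\<close>, and on the diagonal these
  two points differ exactly when \<open>\<sigma>^4\<close> moves \<open>Z\<close>. The condition is
  thus pulled back from the complement of the diagonal, and a polynomial whose nonvanishing implies
  it restricts on the diagonal to a form in \<open>Z\<close> alone.\<close>

definition bimonomial :: "('n::finite \<Rightarrow> nat) \<Rightarrow> ('n \<Rightarrow> nat) \<Rightarrow> 'n dual \<Rightarrow> 'n dual \<Rightarrow> complex" where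
  "bimonomial m m' z z' = (\<Prod>i\<in>UNIV. z $ i ^ m i) * (\<Prod>i\<in>UNIV. z' $ i ^ m' i)"

lemma finite_exponents [simp]: "finite (exponents d :: ('n::finite \<Rightarrow> nat) set)"
proof (rule finite_subset)
  show "(exponents d :: ('n \<Rightarrow> nat) set) \<subseteq> PiE UNIV (\<lambda>_. {..d})"
    by (auto simp: exponents_def intro: member_le_sum)
qed (auto intro: finite_PiE)

lemma exponents_0 [simp]: "(\<lambda>i. 0) \<in> exponents 0"
  by (simp add: exponents_def)

lemma exponents_add:
  "m \<in> exponents d \<Longrightarrow> m' \<in> exponents d' \<Longrightarrow> (\<lambda>i. m i + m' i) \<in> exponents (d + d')"
  by (simp add: exponents_def sum.distrib)

lemma bimonomial_mult:
  "bimonomial m m' z z' * bimonomial n n' z z' = bimonomial (\<lambda>i. m i + n i) (\<lambda>i. m' i + n' i) z z'"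
  by (simp add: bimonomial_def power_add prod.distrib mult_ac)

lemma biform_altdef:
  "biform d e p \<longleftrightarrow> (\<exists>a. \<forall>z z'. p z z' =
     (\<Sum>m\<in>exponents d. \<Sum>m'\<in>exponents e. a m m' * bimonomial m m' z z'))"
  by (simp add: biform_def bimonomial_def mult.assoc)

lemma biform_zero [simp]: "biform d e (\<lambda>z z'. 0)"
  unfolding biform_altdef by (rule exI[of _ "\<lambda>_ _. 0"]) simp

lemma biform_add:
  assumes "biform d e p" "biform d e q" shows "biform d e (\<lambda>z z'. p z z' + q z z')"
proof -
  obtain a b where "\<And>z z'. p z z' = (\<Sum>m\<in>exponents d. \<Sum>m'\<in>exponents e. a m m' * bimonomial m m' z z')"
    "\<And>z z'. q z z' = (\<Sum>m\<in>exponents d. \<Sum>m'\<in>exponents e. b m m' * bimonomial m m' z z')"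
    using assms unfolding biform_altdef by blast
  then show ?thesis
    unfolding biform_altdef
    by (intro exI[of _ "\<lambda>m m'. a m m' + b m m'"]) (simp add: sum.distrib distrib_right)
qed

lemma biform_sum:
  "(\<And>i. i \<in> I \<Longrightarrow> biform d e (p i)) \<Longrightarrow> biform d e (\<lambda>z z'. \<Sum>i\<in>I. p i z z')"
  by (induction I rule: infinite_finite_induct) (auto intro: biform_add)

lemma biform_bimonomial:
  assumes "m \<in> exponents d" "m' \<in> exponents e"
  shows "biform d e (\<lambda>z z'. c * bimonomial m m' z z')"
proof -
  \<comment> \<open>The coefficient family is supported at the single pair \<open>(m, m')\<close>,
    where it is \<open>c\<close>.\<close>
  have "c * bimonomial m m' z z' = (\<Sum>n\<in>exponents d. \<Sum>n'\<in>exponents e.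
      (if n = m then if n' = m' then c else 0 else 0) * bimonomial n n' z z')" for z z'
  proof -
    have "(\<Sum>n'\<in>exponents e. (if n = m then if n' = m' then c else 0 else 0) * bimonomial n n' z z')
        = (if n = m then c * bimonomial m m' z z' else 0)" for n
      using assms by (simp add: if_distrib[of "\<lambda>x. x * _"] cong: if_cong)
    then show ?thesis using assms by simp
  qed
  then show ?thesis
    unfolding biform_altdef
    by (intro exI[of _ "\<lambda>n n'. if n = m then if n' = m' then c else 0 else 0"]) simp
qed

text \<open>Reduces a claim about bihomogeneous polynomials of fixed bidegree to monomials and
  additivity; products, swaps, diagonals and substitutions are all checked on monomials.\<close>

lemma biform_induct [consumes 1, case_names zero add bimonomial]:
  assumes "biform d e p"
    and "P (\<lambda>z z'. 0)"
    and "\<And>p q. P p \<Longrightarrow> P q \<Longrightarrow> P (\<lambda>z z'. p z z' + q z z')"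
    and "\<And>c m m'. m \<in> exponents d \<Longrightarrow> m' \<in> exponents e \<Longrightarrow> P (\<lambda>z z'. c * bimonomial m m' z z')"
  shows "P p"
proof -
  have sum: "P (\<lambda>z z'. \<Sum>i\<in>I. f i z z')" if "\<And>i. i \<in> I \<Longrightarrow> P (f i)" for I :: "('n \<Rightarrow> nat) set" and f
    using that by (induction I rule: infinite_finite_induct) (auto intro: assms)
  obtain a where "\<And>z z'. p z z' = (\<Sum>m\<in>exponents d. \<Sum>m'\<in>exponents e. a m m' * bimonomial m m' z z')"
    using assms unfolding biform_altdef by blast
  then have "p = (\<lambda>z z'. \<Sum>m\<in>exponents d. \<Sum>m'\<in>exponents e. a m m' * bimonomial m m' z z')"
    by blast
  then show ?thesis
    using assms(4) by (auto intro!: sum)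
qed

lemma biform_mult:
  assumes "biform d e p" "biform d' e' q"
  shows "biform (d + d') (e + e') (\<lambda>z z'. p z z' * q z z')"
  using assms(1)
proof (induction rule: biform_induct)
  case (bimonomial c m m')
  from assms(2) show ?case
  proof (induction rule: biform_induct)
    case (bimonomial b n n')
    have "biform (d + d') (e + e')
        (\<lambda>z z'. (c * b) * bimonomial (\<lambda>i. m i + n i) (\<lambda>i. m' i + n' i) z z')"
      using bimonomial \<open>m \<in> exponents d\<close> \<open>m' \<in> exponents e\<close>
      by (intro biform_bimonomial exponents_add) auto
    then show ?case
      by (simp add: bimonomial_mult[symmetric] mult_ac)
  qed (auto simp: distrib_left intro: biform_add)
qed (auto simp: distrib_right intro: biform_add)

lemma biform_const: "biform 0 0 (\<lambda>z z'. c)"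
  using biform_bimonomial[of "\<lambda>_. 0" 0 "\<lambda>_. 0" 0 c] by (simp add: bimonomial_def)

lemma biform_cmult: "biform d e p \<Longrightarrow> biform d e (\<lambda>z z'. c * p z z')"
  using biform_mult[OF biform_const] by fastforce

lemma biform_power: "biform d e p \<Longrightarrow> biform (d * k) (e * k) (\<lambda>z z'. p z z' ^ k)"
proof (induction k)
  case 0
  then show ?case using biform_const[of 1] by simp
next
  case (Suc k)
  then show ?case using biform_mult[of d e p "d * k" "e * k"] by simp
qed

lemma biform_prod:
  assumes "finite I" "\<And>i. i \<in> I \<Longrightarrow> biform (d i) (e i) (p i)"
  shows "biform (\<Sum>i\<in>I. d i) (\<Sum>i\<in>I. e i) (\<lambda>z z'. \<Prod>i\<in>I. p i z z')"
  using assms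
proof (induction I rule: finite_induct)
  case empty
  then show ?case using biform_const[of 1] by simp
next
  case (insert i I)
  then show ?case using biform_mult[of "d i" "e i" "p i"] by simp
qed

lemma prod_power_indicator: "(\<Prod>j\<in>UNIV. f j ^ (if j = i then 1 else 0)) = (f (i::'n::finite) :: complex)"
proof -
  have "(\<Prod>j\<in>UNIV. f j ^ (if j = i then 1 else 0)) = (\<Prod>j\<in>UNIV. if j = i then f j else 1)"
    by (rule prod.cong) auto
  then show ?thesis by simp
qed

lemma biform_nth1: "biform 1 0 (\<lambda>z z'. z $ i)"
  using biform_bimonomial[of "\<lambda>j. if j = i then 1 else 0" 1 "\<lambda>_. 0" 0 1]
  unfolding bimonomial_def prod_power_indicator by (simp add: exponents_def)

lemma biform_nth2: "biform 0 1 (\<lambda>z z'. z' $ i)"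
  using biform_bimonomial[of "\<lambda>_. 0" 0 "\<lambda>j. if j = i then 1 else 0" 1 1]
  unfolding bimonomial_def prod_power_indicator by (simp add: exponents_def)

lemma biform_lin1: "biform 1 0 (\<lambda>z z'. lin Y z)"
  unfolding lin_def by (intro biform_sum biform_cmult biform_nth1)

lemma biform_lin2: "biform 0 1 (\<lambda>z z'. lin Y z')"
  unfolding lin_def by (intro biform_sum biform_cmult biform_nth2)

lemma biform_bil: "biform 1 1 (bil \<omega>)"
proof -
  have "biform 1 1 (\<lambda>z z'. \<omega> $ (i, j) * (z $ i * z' $ j))" for i j
    using biform_cmult[OF biform_mult[OF biform_nth1[of i] biform_nth2[of j]]] by simp
  then show ?thesis
    unfolding bil_def mult.assoc by (intro biform_sum)
qed

lemma biform_form: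
  assumes "form d p" shows "biform d 0 (\<lambda>z z'. p z)"
proof -
  obtain a where a: "\<And>z. p z = (\<Sum>m\<in>exponents d. a m * (\<Prod>i\<in>UNIV. z $ i ^ m i))"
    using assms unfolding form_def by blast
  have "biform d 0 (\<lambda>z z'. \<Sum>m\<in>exponents d. a m * bimonomial m (\<lambda>_. 0) z z')"
    by (intro biform_sum biform_bimonomial) auto
  then show ?thesis by (simp add: a bimonomial_def)
qed

lemma biform_swap:
  assumes "biform d e p" shows "biform e d (\<lambda>z z'. p z' z)"
  using assms
proof (induction rule: biform_induct)
  case (bimonomial c m m')
  then show ?case using biform_bimonomial[of m' e m d c]
    by (simp add: bimonomial_def mult.commute)
qed (auto intro: biform_add)

text \<open>Turns an open condition on pairs near a point \<open>(Z, Z)\<close> into an open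
  condition on \<open>Z\<close> alone.\<close>

lemma biform_diag:
  assumes "biform d e p" shows "biform (d + e) 0 (\<lambda>z z'. p z z)"
  using assms
proof (induction rule: biform_induct)
  case (bimonomial c m m')
  then show ?case using biform_bimonomial[of "\<lambda>i. m i + m' i" "d + e" "\<lambda>_. 0" 0 c]
    by (simp add: bimonomial_def power_add prod.distrib exponents_add)
qed (auto intro: biform_add)

text \<open>A morphism is locally given by forms of one degree, so this is the polynomial side of
  pulling functions back along a pair of morphisms.\<close>

lemma biform_subst:
  assumes "biform d e p" "\<And>i. form k (\<lambda>z. F z $ i)" "\<And>i. form l (\<lambda>z. G z $ i)"
  shows "biform (k * d) (l * e) (\<lambda>z z'. p (F z) (G z'))"
  using assms(1)
proof (induction rule: biform_induct)
  case (bimonomial c m m')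
  \<comment> \<open>The degrees stay sums over \<open>i\<close>, with a factor \<open>0\<close>
    where needed, to fit \<open>biform_prod\<close> and \<open>biform_power\<close>; membership in
    \<open>exponents\<close> evaluates them afterwards.\<close>
  have "biform (\<Sum>i\<in>UNIV. k * m i) (\<Sum>i\<in>UNIV. 0 * m i) (\<lambda>z z'. \<Prod>i\<in>UNIV. F z $ i ^ m i)"
    by (intro biform_prod biform_power biform_form assms) auto
  moreover have "biform (\<Sum>i\<in>UNIV. 0 * m' i) (\<Sum>i\<in>UNIV. l * m' i) (\<lambda>z z'. \<Prod>i\<in>UNIV. G z' $ i ^ m' i)"
    by (intro biform_prod biform_power biform_swap[OF biform_form] assms) auto
  ultimately show ?case
    using bimonomial biform_cmult[OF biform_mult, of "k * d" 0 _ 0 "l * e" _ c]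
    by (simp add: bimonomial_def exponents_def flip: sum_distrib_left)
qed (auto intro: biform_add)

lemma biform_homogeneous:
  assumes "biform d e p" shows "p (c *s z) (c' *s z') = c ^ d * c' ^ e * p z z'"
  using assms
proof (induction rule: biform_induct)
  case (bimonomial a m m')
  then show ?case
    by (simp add: bimonomial_def exponents_def power_mult_distrib prod.distrib flip: power_sum)
qed (auto simp: distrib_left)

section \<open>Points and generic properties\<close>

lemma reps_nonempty: "reps Z \<noteq> {}"
proof -
  obtain v where "v \<noteq> 0" "Rep_proj Z = range (\<lambda>c. c *s v)"
    using Rep_proj[of Z] by blast
  then have "v \<in> reps Z"
    unfolding reps_def by (auto intro: range_eqI[of _ _ 1])
  then show ?thesis by blast
qed

text \<open>The same choice that \<open>ratio\<close> makes, so that ratios and values at chosen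
  representatives agree by unfolding.\<close>

definition rep :: "'n::finite proj \<Rightarrow> 'n dual" where
  "rep Z = (SOME z. z \<in> reps Z)"

lemma rep_in_reps [simp]: "rep Z \<in> reps Z"
  unfolding rep_def using reps_nonempty by (metis some_in_eq)

lemma reps_scale:
  assumes "z \<in> reps Z" "w \<in> reps Z" obtains c where "c \<noteq> 0" "w = c *s z"
proof -
  obtain v where v: "v \<noteq> 0" "Rep_proj Z = range (\<lambda>c. c *s v)"
    using Rep_proj[of Z] by blast
  obtain a b where "z = a *s v" "w = b *s v" "a \<noteq> 0" "b \<noteq> 0"
    using assms v by (auto simp: reps_def)
  then show ?thesis
    by (intro that[of "b / a"]) auto
qed

lemma proj_eqI:
  assumes "z \<in> reps Z" "z \<in> reps Z'" shows "Z = Z'"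
proof -
  have *: "Rep_proj Z = range (\<lambda>c. c *s z)" if z: "z \<in> reps Z" for Z
  proof -
    obtain v where v: "v \<noteq> 0" "Rep_proj Z = range (\<lambda>c. c *s v)"
      using Rep_proj[of Z] by blast
    obtain a where a: "z = a *s v" "a \<noteq> 0"
      using z v by (auto simp: reps_def)
    have "c *s v = (c / a) *s z" for c using a by simp
    then have "c *s v \<in> range (\<lambda>c. c *s z)" for c by (metis rangeI)
    then show ?thesis unfolding v using a by (auto simp: vector_smult_assoc)
  qed
  show ?thesis
    using *[OF assms(1)] *[OF assms(2)] by (metis Rep_proj_inject)
qed

text \<open>The value depends on the chosen representatives; for bihomogeneous polynomials its
  vanishing and the quotients of equal bidegree do not.\<close>

definition ev :: "('n::finite dual \<Rightarrow> 'n dual \<Rightarrow> complex) \<Rightarrow> 'n proj \<times> 'n proj \<Rightarrow> complex" where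
  "ev p x = p (rep (fst x)) (rep (snd x))"

lemma ratio_ev: "ratio p q x = ev p x / ev q x"
  by (cases x) (simp add: ratio_def ev_def rep_def Let_def)

lemma biform_reps_eq_0_iff:
  assumes "biform d e q" "z \<in> reps Z" "z' \<in> reps Z'"
  shows "q z z' = 0 \<longleftrightarrow> ev q (Z, Z') = 0"
proof -
  obtain c c' where "c \<noteq> 0" "z = c *s rep Z" "c' \<noteq> 0" "z' = c' *s rep Z'"
    using reps_scale assms rep_in_reps by metis
  then show ?thesis by (simp add: ev_def biform_homogeneous[OF assms(1)])
qed

lemma biform_reps_ratio:
  assumes "biform d e p" "biform d e q" "z \<in> reps Z" "z' \<in> reps Z'"
  shows "p z z' / q z z' = ev p (Z, Z') / ev q (Z, Z')"
proof -
  obtain c c' where "c \<noteq> 0" "z = c *s rep Z" "c' \<noteq> 0" "z' = c' *s rep Z'"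
    using reps_scale assms rep_in_reps by metis
  then show ?thesis
    by (simp add: ev_def biform_homogeneous[OF assms(1)] biform_homogeneous[OF assms(2)])
qed

lemma vanishes_on_biform:
  assumes "biform d e q" shows "vanishes_on C q \<longleftrightarrow> (\<forall>x\<in>C. ev q x = 0)"
proof
  assume "vanishes_on C q"
  then show "\<forall>x\<in>C. ev q x = 0"
    unfolding vanishes_on_def ev_def by fastforce
next
  assume "\<forall>x\<in>C. ev q x = 0"
  then show "vanishes_on C q"
    unfolding vanishes_on_def using biform_reps_eq_0_iff[OF assms] by blast
qed

text \<open>\<open>P\<close> holds on a basic Zariski open neighbourhood of \<open>x\<close> in
  \<open>C\<close>. The base point is kept because the forms defining a morphism are available only
  near a given point.\<close>

definition near :: "('n::finite proj \<times> 'n proj) set \<Rightarrow> 'n proj \<times> 'n proj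
    \<Rightarrow> ('n proj \<times> 'n proj \<Rightarrow> bool) \<Rightarrow> bool" where
  "near C x P \<longleftrightarrow> x \<in> C \<and> (\<exists>d e q. biform d e q \<and> ev q x \<noteq> 0 \<and> (\<forall>y\<in>C. ev q y \<noteq> 0 \<longrightarrow> P y))"

text \<open>Truth on a nonempty open subset of \<open>C\<close>; on an irreducible set this behaves
  like truth almost everywhere.\<close>

definition generic :: "('n::finite proj \<times> 'n proj) set \<Rightarrow> ('n proj \<times> 'n proj \<Rightarrow> bool) \<Rightarrow> bool" where
  "generic C P \<longleftrightarrow> (\<exists>x. near C x P)"

lemma near_point: "near C x P \<Longrightarrow> P x"
  by (auto simp: near_def)

lemma near_biform: "biform d e q \<Longrightarrow> x \<in> C \<Longrightarrow> ev q x \<noteq> 0 \<Longrightarrow> near C x (\<lambda>y. ev q y \<noteq> 0)"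
  by (auto simp: near_def)

lemma near_True: "x \<in> C \<Longrightarrow> (\<And>y. y \<in> C \<Longrightarrow> P y) \<Longrightarrow> near C x P"
  unfolding near_def using biform_const[of 1] by (fastforce simp: ev_def)

lemma near_mono:
  "near C x P \<Longrightarrow> (\<And>y. y \<in> C \<Longrightarrow> P y \<Longrightarrow> P' y) \<Longrightarrow> near C x P'"
  unfolding near_def by blast

lemma nearI:
  assumes "biform d e q" "x \<in> C" "ev q x \<noteq> 0" "\<And>y. y \<in> C \<Longrightarrow> ev q y \<noteq> 0 \<Longrightarrow> P y"
  shows "near C x P"
  unfolding near_def using assms by blast

lemma nearE:
  assumes "near C x P"
  obtains d e q where "biform d e q" "x \<in> C" "ev q x \<noteq> 0" "\<forall>y\<in>C. ev q y \<noteq> 0 \<longrightarrow> P y"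
  using assms unfolding near_def by (elim exE conjE)

lemma near_conj:
  assumes "near C x P" "near C x P'" shows "near C x (\<lambda>y. P y \<and> P' y)"
proof -
  obtain d e q where q: "biform d e q" "x \<in> C" "ev q x \<noteq> 0" "\<forall>y\<in>C. ev q y \<noteq> 0 \<longrightarrow> P y"
    using assms(1) by (rule nearE)
  obtain d' e' q' where q': "biform d' e' q'" "ev q' x \<noteq> 0" "\<forall>y\<in>C. ev q' y \<noteq> 0 \<longrightarrow> P' y"
    using assms(2) by (rule nearE)
  show ?thesis
    by (rule nearI[OF biform_mult[OF q(1) q'(1)] q(2)]) (use q q' in \<open>auto simp: ev_def\<close>)
qed

lemma generic_mono: "generic C P \<Longrightarrow> (\<And>y. y \<in> C \<Longrightarrow> P y \<Longrightarrow> P' y) \<Longrightarrow> generic C P'"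
  unfolding generic_def using near_mono by blast

lemma biclosed_zeros:
  assumes "biform d e q" shows "biclosed {x. vanishes_on {x} q}"
  unfolding biclosed_def using assms by (intro exI[of _ "{q}"]) auto

text \<open>Two nonempty open subsets of an irreducible set meet: otherwise \<open>C\<close> would
  be covered by the zero sets of \<open>q\<close> and \<open>q'\<close>, neither of which contains
  it.\<close>

lemma generic_conj:
  assumes "irreducible_set C" "generic C P" "generic C P'"
  shows "generic C (\<lambda>y. P y \<and> P' y)"
proof -
  obtain x x' where x: "near C x P" and x': "near C x' P'"
    using assms(2,3) unfolding generic_def by blast
  obtain d e q where q: "biform d e q" "x \<in> C" "ev q x \<noteq> 0" "\<forall>y\<in>C. ev q y \<noteq> 0 \<longrightarrow> P y"
    using x by (rule nearE)
  obtain d' e' q' where q': "biform d' e' q'" "x' \<in> C" "ev q' x' \<noteq> 0" "\<forall>y\<in>C. ev q' y \<noteq> 0 \<longrightarrow> P' y"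
    using x' by (rule nearE)
  have "biclosed {x. vanishes_on {x} q}" "biclosed {x. vanishes_on {x} q'}"
    using q(1) q'(1) by (auto intro: biclosed_zeros)
  moreover have "\<not> C \<subseteq> {x. vanishes_on {x} q}" "\<not> C \<subseteq> {x. vanishes_on {x} q'}"
    using q q' by (auto simp: vanishes_on_biform[OF q(1)] vanishes_on_biform[OF q'(1)])
  ultimately have "\<not> C \<subseteq> {x. vanishes_on {x} q} \<union> {x. vanishes_on {x} q'}"
    using assms(1) unfolding irreducible_set_def by blast
  then obtain y where y: "y \<in> C" "ev q y \<noteq> 0" "ev q' y \<noteq> 0"
    by (auto simp: vanishes_on_biform[OF q(1)] vanishes_on_biform[OF q'(1)])
  have "near C y P" "near C y P'"
    using q q' y by (auto intro: nearI)
  then show ?thesis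
    unfolding generic_def using near_conj by blast
qed

lemma generic_biform:
  "biform d e q \<Longrightarrow> \<not> vanishes_on C q \<Longrightarrow> generic C (\<lambda>y. ev q y \<noteq> 0)"
  unfolding generic_def using near_biform by (metis vanishes_on_biform)

lemma generic_True:
  assumes "irreducible_set C" "\<And>y. y \<in> C \<Longrightarrow> P y" shows "generic C P"
proof -
  obtain x where "x \<in> C" using assms(1) unfolding irreducible_set_def by blast
  then have "near C x P" using assms(2) by (rule near_True)
  then show ?thesis unfolding generic_def by (rule exI)
qed

text \<open>The definition asks for \<open>f = p / q\<close> wherever \<open>q\<close> does not
  vanish. Equality on a smaller nonempty open set is enough: multiplying numerator and denominator
  by a polynomial \<open>u\<close> whose nonvanishing forces a point into that set shrinks the
  requirement accordingly.\<close>

lemma mero_rep_iff: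
  "f \<in> mero_rep C \<longleftrightarrow> (\<exists>d e p q. biform d e p \<and> biform d e q \<and>
     generic C (\<lambda>x. ev q x \<noteq> 0 \<and> f x = ev p x / ev q x))"
proof
  assume "f \<in> mero_rep C"
  then obtain d e p q where 1: "biform d e p" "biform d e q" "\<not> vanishes_on C q" and
    2: "\<And>Z Z' z z'. (Z, Z') \<in> C \<Longrightarrow> z \<in> reps Z \<Longrightarrow> z' \<in> reps Z' \<Longrightarrow> q z z' \<noteq> 0 \<Longrightarrow> f (Z, Z') = p z z' / q z z'"
    unfolding mero_rep_def by fast
  have "generic C (\<lambda>x. ev q x \<noteq> 0 \<and> f x = ev p x / ev q x)"
    using generic_biform[OF 1(2,3)]
    by (rule generic_mono) (use 2 in \<open>auto simp: ev_def\<close>)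
  with 1 show "\<exists>d e p q. biform d e p \<and> biform d e q \<and>
     generic C (\<lambda>x. ev q x \<noteq> 0 \<and> f x = ev p x / ev q x)" by blast
next
  assume "\<exists>d e p q. biform d e p \<and> biform d e q \<and>
     generic C (\<lambda>x. ev q x \<noteq> 0 \<and> f x = ev p x / ev q x)"
  then obtain d e p q where 1: "biform d e p" "biform d e q"
    and gen: "generic C (\<lambda>x. ev q x \<noteq> 0 \<and> f x = ev p x / ev q x)"
    by (elim exE conjE)
  obtain x where x: "near C x (\<lambda>x. ev q x \<noteq> 0 \<and> f x = ev p x / ev q x)"
    using gen unfolding generic_def by (elim exE)
  obtain d' e' u where u: "biform d' e' u" "x \<in> C" "ev u x \<noteq> 0" and
    2: "\<forall>y\<in>C. ev u y \<noteq> 0 \<longrightarrow> ev q y \<noteq> 0 \<and> f y = ev p y / ev q y"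
    using x by (rule nearE)
  have p: "biform (d + d') (e + e') (\<lambda>z z'. p z z' * u z z')"
    and q: "biform (d + d') (e + e') (\<lambda>z z'. q z z' * u z z')"
    by (rule biform_mult[OF 1(1) u(1)], rule biform_mult[OF 1(2) u(1)])
  moreover have "\<not> vanishes_on C (\<lambda>z z'. q z z' * u z z')"
    unfolding vanishes_on_biform[OF q] using u 2 by (auto simp: ev_def)
  moreover have "f (Z, Z') = p z z' * u z z' / (q z z' * u z z')"
    if "(Z, Z') \<in> C" "z \<in> reps Z" "z' \<in> reps Z'" "q z z' * u z z' \<noteq> 0" for Z Z' z z'
  proof -
    have "ev u (Z, Z') \<noteq> 0"
      using that biform_reps_eq_0_iff[OF u(1) that(2,3)] by simp
    with that 2 show ?thesis
      using biform_reps_ratio[OF 1(1,2) that(2,3)] by simp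
  qed
  ultimately show "f \<in> mero_rep C"
    unfolding mero_rep_def mem_Collect_eq
    by (intro exI[of _ "d + d'"] exI[of _ "e + e'"] exI[of _ "\<lambda>z z'. p z z' * u z z'"]
        exI[of _ "\<lambda>z z'. q z z' * u z z'"]) auto
qed

text \<open>Describes the open set without a base point, in the wording of
  \<open>mero_null\<close>.\<close>

lemma generic_altdef:
  "generic C P \<longleftrightarrow>
     (\<exists>d e q. biform d e q \<and> \<not> vanishes_on C q \<and> (\<forall>x\<in>C. \<not> vanishes_on {x} q \<longrightarrow> P x))"
proof
  assume "generic C P"
  then obtain d e q x where q: "biform d e q" and x: "x \<in> C" "ev q x \<noteq> 0"
    and P: "\<forall>y\<in>C. ev q y \<noteq> 0 \<longrightarrow> P y"
    unfolding generic_def near_def by (elim exE conjE)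
  have "\<not> vanishes_on C q" "\<forall>x\<in>C. \<not> vanishes_on {x} q \<longrightarrow> P x"
    using q x P by (auto simp: vanishes_on_biform)
  with q show "\<exists>d e q. biform d e q \<and> \<not> vanishes_on C q \<and> (\<forall>x\<in>C. \<not> vanishes_on {x} q \<longrightarrow> P x)"
    by (intro exI[of _ d] exI[of _ e] exI[of _ q] conjI)
next
  assume "\<exists>d e q. biform d e q \<and> \<not> vanishes_on C q \<and> (\<forall>x\<in>C. \<not> vanishes_on {x} q \<longrightarrow> P x)"
  then obtain d e q where q: "biform d e q" and 1: "\<not> vanishes_on C q"
    "\<forall>x\<in>C. \<not> vanishes_on {x} q \<longrightarrow> P x"
    by (elim exE conjE)
  from generic_biform[OF q 1(1)] show "generic C P"
    by (rule generic_mono) (use 1(2) in \<open>auto simp: vanishes_on_biform[OF q]\<close>)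
qed

lemma mero_null_iff: "f \<in> mero_null C \<longleftrightarrow> f \<in> mero_rep C \<and> generic C (\<lambda>x. f x = 0)"
  by (simp add: mero_null_def generic_altdef)

lemma mero_repI:
  assumes "biform d e p" "biform d e q" "generic C (\<lambda>x. ev q x \<noteq> 0 \<and> f x = ev p x / ev q x)"
  shows "f \<in> mero_rep C"
  unfolding mero_rep_iff using assms by (intro exI[of _ d] exI[of _ e] exI[of _ p] exI[of _ q] conjI)

lemma mero_repE:
  assumes "f \<in> mero_rep C"
  obtains d e p q where "biform d e p" "biform d e q"
    "generic C (\<lambda>x. ev q x \<noteq> 0 \<and> f x = ev p x / ev q x)"
  using assms unfolding mero_rep_iff by (elim exE conjE)

lemma mero_rep_const: "irreducible_set C \<Longrightarrow> (\<lambda>_. c) \<in> mero_rep C"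
  by (rule mero_repI[OF biform_const biform_const[of 1]]) (auto simp: ev_def intro: generic_True)

lemma mero_rep_ratio:
  assumes "biform d e p" "biform d e q" "\<not> vanishes_on C q" shows "ratio p q \<in> mero_rep C"
proof (rule mero_repI[OF assms(1,2)])
  show "generic C (\<lambda>x. ev q x \<noteq> 0 \<and> ratio p q x = ev p x / ev q x)"
    using generic_biform[OF assms(2,3)] by (rule generic_mono) (simp add: ratio_ev)
qed

lemma mero_rep_add:
  assumes "irreducible_set C" "f \<in> mero_rep C" "g \<in> mero_rep C"
  shows "(\<lambda>x. f x + g x) \<in> mero_rep C"
proof -
  obtain d e p q where f: "biform d e p" "biform d e q"
    "generic C (\<lambda>x. ev q x \<noteq> 0 \<and> f x = ev p x / ev q x)"
    using assms(2) by (rule mero_repE)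
  obtain d' e' p' q' where g: "biform d' e' p'" "biform d' e' q'"
    "generic C (\<lambda>x. ev q' x \<noteq> 0 \<and> g x = ev p' x / ev q' x)"
    using assms(3) by (rule mero_repE)
  let ?p = "\<lambda>z z'. p z z' * q' z z' + q z z' * p' z z'" and ?q = "\<lambda>z z'. q z z' * q' z z'"
  have "generic C (\<lambda>x. ev ?q x \<noteq> 0 \<and> f x + g x = ev ?p x / ev ?q x)"
    using generic_conj[OF assms(1) f(3) g(3)]
    by (rule generic_mono) (auto simp: ev_def field_simps)
  from mero_repI[OF biform_add[OF biform_mult[OF f(1) g(2)] biform_mult[OF f(2) g(1)]]
      biform_mult[OF f(2) g(2)] this]
  show ?thesis .
qed

lemma mero_rep_mult:
  assumes "irreducible_set C" "f \<in> mero_rep C" "g \<in> mero_rep C"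
  shows "(\<lambda>x. f x * g x) \<in> mero_rep C"
proof -
  obtain d e p q where f: "biform d e p" "biform d e q"
    "generic C (\<lambda>x. ev q x \<noteq> 0 \<and> f x = ev p x / ev q x)"
    using assms(2) by (rule mero_repE)
  obtain d' e' p' q' where g: "biform d' e' p'" "biform d' e' q'"
    "generic C (\<lambda>x. ev q' x \<noteq> 0 \<and> g x = ev p' x / ev q' x)"
    using assms(3) by (rule mero_repE)
  let ?p = "\<lambda>z z'. p z z' * p' z z'" and ?q = "\<lambda>z z'. q z z' * q' z z'"
  have "generic C (\<lambda>x. ev ?q x \<noteq> 0 \<and> f x * g x = ev ?p x / ev ?q x)"
    using generic_conj[OF assms(1) f(3) g(3)] by (rule generic_mono) (auto simp: ev_def)
  from mero_repI[OF biform_mult[OF f(1) g(1)] biform_mult[OF f(2) g(2)] this]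
  show ?thesis .
qed

lemma mero_rep_sum:
  assumes "irreducible_set C" "\<And>i. i \<in> I \<Longrightarrow> f i \<in> mero_rep C"
  shows "(\<lambda>x. \<Sum>i\<in>I. f i x) \<in> mero_rep C"
  using assms(2)
  by (induction I rule: infinite_finite_induct) (auto intro: mero_rep_const mero_rep_add assms(1))

section \<open>Pullback along products of regular maps\<close>

text \<open>Abstracts from the twist because it is used twice, for
  \<open>(\<sigma>, \<sigma>^-1)\<close> and for the inverse pair. Invariance is an equality of
  sets, so the map is onto \<open>C\<close>.\<close>

locale invariant_component =
  fixes E :: "'n::finite proj set" and C :: "('n proj \<times> 'n proj) set"
    and \<alpha> \<beta> :: "'n proj \<Rightarrow> 'n proj"
  assumes subset: "C \<subseteq> E \<times> E"
    and regular: "regular_map_on E \<alpha>" "regular_map_on E \<beta>"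
    and invariant: "map_prod \<alpha> \<beta> ` C = C"
begin

text \<open>Neither \<open>F\<close> nor \<open>G\<close> vanishes at \<open>x\<close>, so each has
  a nonzero coordinate there; where these two coordinates stay nonzero, \<open>F\<close> and
  \<open>G\<close> compute the morphisms.\<close>

lemma near_pullback:
  assumes "x \<in> C"
  obtains k l F G where "\<forall>i. form k (\<lambda>z. F z $ i)" "\<forall>i. form l (\<lambda>z. G z $ i)"
    "near C x (\<lambda>y. F (rep (fst y)) \<in> reps (\<alpha> (fst y)) \<and> G (rep (snd y)) \<in> reps (\<beta> (snd y)))"
proof -
  obtain X X' where x: "x = (X, X')" "X \<in> E" "X' \<in> E"
    using assms subset by (cases x) auto
  obtain k F where F: "\<And>i. form k (\<lambda>z. F z $ i)" "\<And>z. z \<in> reps X \<Longrightarrow> F z \<noteq> 0"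
    "\<And>Z z. Z \<in> E \<Longrightarrow> z \<in> reps Z \<Longrightarrow> F z \<noteq> 0 \<Longrightarrow> F z \<in> reps (\<alpha> Z)"
    using regular(1) x unfolding regular_map_on_def by metis
  obtain l G where G: "\<And>i. form l (\<lambda>z. G z $ i)" "\<And>z. z \<in> reps X' \<Longrightarrow> G z \<noteq> 0"
    "\<And>Z z. Z \<in> E \<Longrightarrow> z \<in> reps Z \<Longrightarrow> G z \<noteq> 0 \<Longrightarrow> G z \<in> reps (\<beta> Z)"
    using regular(2) x unfolding regular_map_on_def by metis
  obtain i j where ij: "F (rep X) $ i \<noteq> 0" "G (rep X') $ j \<noteq> 0"
    using F(2)[of "rep X"] G(2)[of "rep X'"] by (auto simp: vec_eq_iff)
  have "near C x (\<lambda>y. ev (\<lambda>z z'. F z $ i) y \<noteq> 0)" "near C x (\<lambda>y. ev (\<lambda>z z'. G z' $ j) y \<noteq> 0)"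
    using ij assms near_biform[OF biform_form[OF F(1)], of x C i]
      near_biform[OF biform_swap[OF biform_form[OF G(1)]], of x C j]
    by (simp_all add: x ev_def)
  from near_conj[OF this]
  have "near C x (\<lambda>y. F (rep (fst y)) \<in> reps (\<alpha> (fst y)) \<and> G (rep (snd y)) \<in> reps (\<beta> (snd y)))"
  proof (rule near_mono)
    fix y assume "y \<in> C" and nz: "ev (\<lambda>z z'. F z $ i) y \<noteq> 0 \<and> ev (\<lambda>z z'. G z' $ j) y \<noteq> 0"
    then have "fst y \<in> E" "snd y \<in> E" using subset by auto
    moreover have "F (rep (fst y)) \<noteq> 0" "G (rep (snd y)) \<noteq> 0"
      using nz by (auto simp: ev_def)
    ultimately show "F (rep (fst y)) \<in> reps (\<alpha> (fst y)) \<and> G (rep (snd y)) \<in> reps (\<beta> (snd y))"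
      using F(3) G(3) by simp
  qed
  then show ?thesis using F(1) G(1) by (intro that[of k F l G]) auto
qed

text \<open>Continuity: near \<open>x\<close>, the preimage of the nonvanishing locus of
  \<open>q\<close> is that of \<open>q (F z) (G z')\<close>.\<close>

lemma near_comp:
  assumes "x \<in> C" "near C (map_prod \<alpha> \<beta> x) P"
  shows "near C x (\<lambda>y. P (map_prod \<alpha> \<beta> y))"
proof -
  obtain d e q where q: "biform d e q" "ev q (map_prod \<alpha> \<beta> x) \<noteq> 0"
    and P: "\<forall>y\<in>C. ev q y \<noteq> 0 \<longrightarrow> P y"
    using assms(2) by (rule nearE)
  obtain k l F G where FG: "\<forall>i. form k (\<lambda>z. F z $ i)" "\<forall>i. form l (\<lambda>z. G z $ i)"
    "near C x (\<lambda>y. F (rep (fst y)) \<in> reps (\<alpha> (fst y)) \<and> G (rep (snd y)) \<in> reps (\<beta> (snd y)))"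
    using assms(1) by (rule near_pullback)
  have iff: "ev (\<lambda>z z'. q (F z) (G z')) y = 0 \<longleftrightarrow> ev q (map_prod \<alpha> \<beta> y) = 0"
    if "F (rep (fst y)) \<in> reps (\<alpha> (fst y)) \<and> G (rep (snd y)) \<in> reps (\<beta> (snd y))" for y
    using biform_reps_eq_0_iff[OF q(1), of "F (rep (fst y))" "\<alpha> (fst y)" "G (rep (snd y))" "\<beta> (snd y)"] that
    by (cases y) (simp add: ev_def)
  have "near C x (\<lambda>y. ev (\<lambda>z z'. q (F z) (G z')) y \<noteq> 0)"
    using iff[OF near_point[OF FG(3)]] q assms(1)
    by (intro near_biform[OF biform_subst[OF q(1) FG(1)[rule_format] FG(2)[rule_format]]]) auto
  from near_conj[OF FG(3) this] show ?thesis
  proof (rule near_mono)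
    fix y assume "y \<in> C" and y: "(F (rep (fst y)) \<in> reps (\<alpha> (fst y)) \<and> G (rep (snd y)) \<in> reps (\<beta> (snd y)))
      \<and> ev (\<lambda>z z'. q (F z) (G z')) y \<noteq> 0"
    then have "map_prod \<alpha> \<beta> y \<in> C" using invariant by blast
    with y show "P (map_prod \<alpha> \<beta> y)" using P iff[of y] by auto
  qed
qed

text \<open>Surjectivity of the map on \<open>C\<close> makes the preimage of a nonempty open set
  nonempty.\<close>

lemma generic_comp:
  assumes "generic C P" shows "generic C (\<lambda>y. P (map_prod \<alpha> \<beta> y))"
proof -
  obtain x where x: "near C x P" using assms by (auto simp: generic_def)
  then have "x \<in> C" by (simp add: near_def)
  then have "x \<in> map_prod \<alpha> \<beta> ` C" using invariant by simp
  then obtain y where "x = map_prod \<alpha> \<beta> y" "y \<in> C" by (rule imageE)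
  with x have "near C y (\<lambda>y. P (map_prod \<alpha> \<beta> y))" by (intro near_comp) auto
  then show ?thesis unfolding generic_def by (rule exI)
qed

text \<open>Local forms express the pullback as a quotient of polynomials only near one point
  \<open>x\<close>; by \<open>mero_rep_iff\<close> that already makes it a representative on all of
  \<open>C\<close>.\<close>

lemma mero_rep_comp:
  assumes "f \<in> mero_rep C" shows "(\<lambda>y. f (map_prod \<alpha> \<beta> y)) \<in> mero_rep C"
proof -
  obtain d e p q where pq: "biform d e p" "biform d e q"
    and f: "generic C (\<lambda>x. ev q x \<noteq> 0 \<and> f x = ev p x / ev q x)"
    using assms by (rule mero_repE)
  obtain x where x: "near C x (\<lambda>y. ev q (map_prod \<alpha> \<beta> y) \<noteq> 0 \<and>
      f (map_prod \<alpha> \<beta> y) = ev p (map_prod \<alpha> \<beta> y) / ev q (map_prod \<alpha> \<beta> y))"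
    using generic_comp[OF f] unfolding generic_def by (elim exE)
  then have xC: "x \<in> C" by (simp add: near_def)
  obtain k l F G where FG: "\<forall>i. form k (\<lambda>z. F z $ i)" "\<forall>i. form l (\<lambda>z. G z $ i)"
    "near C x (\<lambda>y. F (rep (fst y)) \<in> reps (\<alpha> (fst y)) \<and> G (rep (snd y)) \<in> reps (\<beta> (snd y)))"
    using xC by (rule near_pullback)
  from near_conj[OF x FG(3)]
  have "near C x (\<lambda>y. ev (\<lambda>z z'. q (F z) (G z')) y \<noteq> 0 \<and>
      f (map_prod \<alpha> \<beta> y) = ev (\<lambda>z z'. p (F z) (G z')) y / ev (\<lambda>z z'. q (F z) (G z')) y)"
  proof (rule near_mono)
    fix y assume y: "(ev q (map_prod \<alpha> \<beta> y) \<noteq> 0 \<and>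
      f (map_prod \<alpha> \<beta> y) = ev p (map_prod \<alpha> \<beta> y) / ev q (map_prod \<alpha> \<beta> y)) \<and>
      F (rep (fst y)) \<in> reps (\<alpha> (fst y)) \<and> G (rep (snd y)) \<in> reps (\<beta> (snd y))"
    obtain Z Z' where [simp]: "y = (Z, Z')" by (cases y)
    have "F (rep Z) \<in> reps (\<alpha> Z)" "G (rep Z') \<in> reps (\<beta> Z')" using y by auto
    from biform_reps_ratio[OF pq this] biform_reps_eq_0_iff[OF pq(2) this] y
    show "ev (\<lambda>z z'. q (F z) (G z')) y \<noteq> 0 \<and>
      f (map_prod \<alpha> \<beta> y) = ev (\<lambda>z z'. p (F z) (G z')) y / ev (\<lambda>z z'. q (F z) (G z')) y"
      by (simp add: ev_def)
  qed
  then have "generic C (\<lambda>y. ev (\<lambda>z z'. q (F z) (G z')) y \<noteq> 0 \<and>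
      f (map_prod \<alpha> \<beta> y) = ev (\<lambda>z z'. p (F z) (G z')) y / ev (\<lambda>z z'. q (F z) (G z')) y)"
    unfolding generic_def by (rule exI)
  from mero_repI[OF biform_subst[OF pq(1) FG(1)[rule_format] FG(2)[rule_format]]
      biform_subst[OF pq(2) FG(1)[rule_format] FG(2)[rule_format]] this]
  show ?thesis .
qed

end

section \<open>Free algebras and quotients\<close>

locale complex_algebra = ring A for A :: "(complex, 'a) module" (structure) +
  assumes smult_closed [simp]: "x \<in> carrier A \<Longrightarrow> c \<odot> x \<in> carrier A"
    and smult_add_left: "x \<in> carrier A \<Longrightarrow> (c + d) \<odot> x = c \<odot> x \<oplus> d \<odot> x"
    and smult_add_right: "x \<in> carrier A \<Longrightarrow> y \<in> carrier A \<Longrightarrow> c \<odot> (x \<oplus> y) = c \<odot> x \<oplus> c \<odot> y"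
    and smult_smult: "x \<in> carrier A \<Longrightarrow> c \<odot> (d \<odot> x) = (c * d) \<odot> x"
    and smult_one [simp]: "x \<in> carrier A \<Longrightarrow> 1 \<odot> x = x"
    and smult_mult_left: "x \<in> carrier A \<Longrightarrow> y \<in> carrier A \<Longrightarrow> (c \<odot> x) \<otimes> y = c \<odot> (x \<otimes> y)"
    and smult_mult_right: "x \<in> carrier A \<Longrightarrow> y \<in> carrier A \<Longrightarrow> x \<otimes> (c \<odot> y) = c \<odot> (x \<otimes> y)"
begin

lemma smult_0 [simp]: assumes "x \<in> carrier A" shows "0 \<odot> x = \<zero>"
proof -
  have "0 \<odot> x \<oplus> 0 \<odot> x = 0 \<odot> x"
    using smult_add_left[OF assms, of 0 0] by simp
  then show ?thesis using assms by (simp add: add.r_cancel_one)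
qed

lemma smult_zero [simp]: "c \<odot> \<zero> = \<zero>"
  using smult_smult[of \<zero> c 0] by simp

lemma smult_finsum:
  "(\<And>i. i \<in> I \<Longrightarrow> f i \<in> carrier A) \<Longrightarrow> c \<odot> (\<Oplus>i\<in>I. f i) = (\<Oplus>i\<in>I. c \<odot> f i)"
  by (induction I rule: infinite_finite_induct) (auto simp: smult_add_right)

text \<open>A scalar multiple of \<open>x\<close> is the ring product of
  \<open>c \<odot> \<one>\<close> with \<open>x\<close>, so ring ideals are subspaces and their
  quotients are algebras.\<close>

lemma ideal_smult_closed:
  assumes "ideal I A" "x \<in> I" shows "c \<odot> x \<in> I"
proof -
  interpret I: ideal I A by fact
  have x: "x \<in> carrier A" using assms by simp
  have "(c \<odot> \<one>) \<otimes> x \<in> I" using assms x by (simp add: I.I_l_closed)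
  then show ?thesis using x by (simp add: smult_mult_left)
qed

text \<open>All laws are inherited along a map onto \<open>carrier B\<close> that respects the
  operations; negatives come from the images \<open>h (\<ominus> a)\<close>. Applied to the coset
  map.\<close>

lemma complex_algebra_image:
  assumes "carrier B = h ` carrier A"
    and "\<And>x y. x \<in> carrier A \<Longrightarrow> y \<in> carrier A \<Longrightarrow> h x \<oplus>\<^bsub>B\<^esub> h y = h (x \<oplus> y)"
    and "\<And>x y. x \<in> carrier A \<Longrightarrow> y \<in> carrier A \<Longrightarrow> h x \<otimes>\<^bsub>B\<^esub> h y = h (x \<otimes> y)"
    and "\<And>x c. x \<in> carrier A \<Longrightarrow> c \<odot>\<^bsub>B\<^esub> h x = h (c \<odot> x)"
    and "\<zero>\<^bsub>B\<^esub> = h \<zero>" and "\<one>\<^bsub>B\<^esub> = h \<one>"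
  shows "complex_algebra B"
proof (intro complex_algebra.intro complex_algebra_axioms.intro ringI abelian_groupI monoidI)
  fix x assume "x \<in> carrier B"
  then obtain a where a: "x = h a" "a \<in> carrier A" using assms(1) by blast
  then have "h (\<ominus> a) \<oplus>\<^bsub>B\<^esub> x = \<zero>\<^bsub>B\<^esub>" by (simp add: assms l_neg)
  then show "\<exists>y\<in>carrier B. y \<oplus>\<^bsub>B\<^esub> x = \<zero>\<^bsub>B\<^esub>" using a assms(1) by auto
qed (auto simp: assms(1,5,6) assms(2-4) a_ac m_assoc l_distr r_distr smult_add_left
      smult_add_right smult_smult smult_mult_left smult_mult_right)

end

lemma carrier_quot_algebra: "carrier (quot_algebra A I) = (\<lambda>x. I +>\<^bsub>A\<^esub> x) ` carrier A"
  by (auto simp: quot_algebra_def FactRing_def A_RCOSETS_def')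

locale algebra_ideal = complex_algebra A + I: ideal I A for A (structure) and I
begin

lemma coset_ops:
  assumes "x \<in> carrier A" "y \<in> carrier A"
  shows "(I +> x) \<oplus>\<^bsub>quot_algebra A I\<^esub> (I +> y) = I +> (x \<oplus> y)"
    and "(I +> x) \<otimes>\<^bsub>quot_algebra A I\<^esub> (I +> y) = I +> (x \<otimes> y)"
  using assms by (simp_all add: quot_algebra_def FactRing_def I.rcoset_mult_add I.a_rcos_sum)

lemma coset_eq_iff:
  assumes "x \<in> carrier A" "y \<in> carrier A"
  shows "I +> x = I +> y \<longleftrightarrow> x \<ominus> y \<in> I"
  using assms quotient_eq_iff_same_a_r_cos[OF I.is_ideal] by blast

text \<open>In \<open>quot_algebra\<close> the scalar multiple is a union over all representatives
  of the coset; since the ideal is closed under scalars, the cosets in this union coincide.\<close>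

lemma coset_smult:
  assumes x: "x \<in> carrier A"
  shows "c \<odot>\<^bsub>quot_algebra A I\<^esub> (I +> x) = I +> (c \<odot> x)"
proof -
  have "I +> (c \<odot> y) = I +> (c \<odot> x)" if "y \<in> I +> x" for y
  proof -
    obtain i where i: "i \<in> I" "y = i \<oplus> x"
      using \<open>y \<in> I +> x\<close> by (auto simp: a_r_coset_def r_coset_def)
    then have carr: "i \<in> carrier A" by simp
    have "c \<odot> y \<ominus> c \<odot> x = c \<odot> i"
      unfolding i(2) smult_add_right[OF carr x] a_minus_def
      using carr x by (simp add: a_assoc r_neg)
    then show ?thesis
      using carr x i ideal_smult_closed[OF I.is_ideal i(1), of c]
      by (subst coset_eq_iff) auto
  qed
  moreover have "x \<in> I +> x" using x by (rule I.a_rcos_self)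
  ultimately have "(\<Union>y\<in>I +> x. I +> (c \<odot> y)) = I +> (c \<odot> x)" by blast
  then show ?thesis by (simp add: quot_algebra_def)
qed

lemma coset_consts:
  "\<zero>\<^bsub>quot_algebra A I\<^esub> = I +> \<zero>" "\<one>\<^bsub>quot_algebra A I\<^esub> = I +> \<one>"
  using I.a_subset by (simp_all add: quot_algebra_def FactRing_def)

lemma quot_complex_algebra: "complex_algebra (quot_algebra A I)"
  by (rule complex_algebra_image[of _ "\<lambda>x. I +> x"])
    (auto simp: carrier_quot_algebra coset_ops coset_smult coset_consts)

lemma coset_hom: "(\<lambda>x. I +> x) \<in> algebra_hom A (quot_algebra A I)"
  by (auto simp: algebra_hom_def carrier_quot_algebra coset_ops coset_smult coset_consts
      intro!: ring_hom_memI)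

end

lemma algebra_hom_comp:
  "g \<in> algebra_hom A B \<Longrightarrow> h \<in> algebra_hom B D \<Longrightarrow> h \<circ> g \<in> algebra_hom A D"
  by (auto simp: algebra_hom_def ring_hom_def Pi_iff)

lemma algebra_homD:
  assumes "h \<in> algebra_hom A B"
  shows "x \<in> carrier A \<Longrightarrow> h x \<in> carrier B"
    and "x \<in> carrier A \<Longrightarrow> y \<in> carrier A \<Longrightarrow> h (x \<oplus>\<^bsub>A\<^esub> y) = h x \<oplus>\<^bsub>B\<^esub> h y"
    and "x \<in> carrier A \<Longrightarrow> y \<in> carrier A \<Longrightarrow> h (x \<otimes>\<^bsub>A\<^esub> y) = h x \<otimes>\<^bsub>B\<^esub> h y"
    and "x \<in> carrier A \<Longrightarrow> h (c \<odot>\<^bsub>A\<^esub> x) = c \<odot>\<^bsub>B\<^esub> h x"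
    and "h \<one>\<^bsub>A\<^esub> = \<one>\<^bsub>B\<^esub>"
  using assms by (auto simp: algebra_hom_def ring_hom_def Pi_iff)

text \<open>Universal property of the quotient by the ideal generated by \<open>S\<close>: the
  kernel of \<open>h\<close> is an ideal containing \<open>S\<close>, hence contains the generated
  one.\<close>

lemma factor_algebra_hom:
  fixes A :: "(complex, 'a) module" and B :: "(complex, 'b) module"
  assumes A: "complex_algebra A" and B: "complex_algebra B" and h: "h \<in> algebra_hom A B"
    and S: "S \<subseteq> carrier A" "\<And>x. x \<in> S \<Longrightarrow> h x = \<zero>\<^bsub>B\<^esub>"
  obtains k where "k \<in> algebra_hom (quot_algebra A (Idl\<^bsub>A\<^esub> S)) B"
    "k \<in> extensional (carrier (quot_algebra A (Idl\<^bsub>A\<^esub> S)))"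
    "\<forall>x\<in>carrier A. k (Idl\<^bsub>A\<^esub> S +>\<^bsub>A\<^esub> x) = h x"
proof -
  interpret A: complex_algebra A by fact
  interpret B: complex_algebra B by fact
  have "h \<in> ring_hom A B" using h by (simp add: algebra_hom_def)
  then interpret h: ring_hom_ring A B h
    by (rule ring_hom_ringI2[OF A.ring_axioms B.ring_axioms])
  define I where "I = Idl\<^bsub>A\<^esub> S"
  have "ideal I A" unfolding I_def using S(1) by (rule A.genideal_ideal)
  then interpret algebra_ideal A I
    by (rule algebra_ideal.intro[OF A])
  have "S \<subseteq> a_kernel A B h"
    unfolding a_kernel_def' using S by blast
  with h.kernel_is_ideal have "I \<subseteq> a_kernel A B h"
    unfolding I_def by (rule A.genideal_minimal)
  then have ker: "h x = \<zero>\<^bsub>B\<^esub>" if "x \<in> I" for x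
    using that unfolding a_kernel_def' by blast
  have wd: "h x = h y" if "x \<in> carrier A" "y \<in> carrier A" "I +>\<^bsub>A\<^esub> x = I +>\<^bsub>A\<^esub> y" for x y
  proof -
    have "h (x \<ominus>\<^bsub>A\<^esub> y) = \<zero>\<^bsub>B\<^esub>" using that by (intro ker) (simp add: coset_eq_iff)
    then have "h x \<oplus>\<^bsub>B\<^esub> \<ominus>\<^bsub>B\<^esub> h y = \<zero>\<^bsub>B\<^esub>" using that by (simp add: a_minus_def)
    then have "\<ominus>\<^bsub>B\<^esub> (\<ominus>\<^bsub>B\<^esub> h y) = h x" using that by (intro B.minus_equality) auto
    then show ?thesis using that by simp
  qed
  \<comment> \<open>Picks some representative of each coset; \<open>wd\<close> makes the value
    independent of it. The restriction to the carrier gives extensionality.\<close>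
  define k where "k = (\<lambda>X\<in>carrier (quot_algebra A I). h (SOME x. x \<in> carrier A \<and> I +>\<^bsub>A\<^esub> x = X))"
  have k: "k (I +>\<^bsub>A\<^esub> x) = h x" if "x \<in> carrier A" for x
  proof -
    let ?y = "SOME y. y \<in> carrier A \<and> I +>\<^bsub>A\<^esub> y = I +>\<^bsub>A\<^esub> x"
    have "?y \<in> carrier A \<and> I +>\<^bsub>A\<^esub> ?y = I +>\<^bsub>A\<^esub> x" by (rule someI[of _ x]) (simp add: that)
    then have "h ?y = h x" using wd that by blast
    then show ?thesis using that by (simp add: k_def carrier_quot_algebra)
  qed
  have "k \<in> algebra_hom (quot_algebra A I) B"
    using algebra_homD[OF h]
    by (auto simp: algebra_hom_def carrier_quot_algebra coset_ops coset_smult coset_consts k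
      intro!: ring_hom_memI)
  moreover have "k \<in> extensional (carrier (quot_algebra A I))"
    by (simp add: k_def)
  moreover have "\<forall>x\<in>carrier A. k (I +>\<^bsub>A\<^esub> x) = h x"
    using k by blast
  ultimately show ?thesis unfolding I_def by (rule that)
qed

definition word :: "'g list \<Rightarrow> 'g list \<Rightarrow> complex" where
  "word u = (\<lambda>w. if w = u then 1 else 0)"

text \<open>The product of \<open>free_algebra\<close>, taken out of the record so that identities
  can be proved by induction on the word.\<close>

definition conv :: "('g list \<Rightarrow> complex) \<Rightarrow> ('g list \<Rightarrow> complex) \<Rightarrow> 'g list \<Rightarrow> complex" where
  "conv f g w = (\<Sum>k\<le>length w. f (take k w) * g (drop k w))"

lemma conv_Nil: "conv f g [] = f [] * g []"
  by (simp add: conv_def)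

text \<open>Splits off the cut before the first letter; every other cut gives that letter to
  \<open>f\<close>. This recursion drives the inductions on words.\<close>

lemma conv_Cons: "conv f g (x # w) = f [] * g (x # w) + conv (\<lambda>v. f (x # v)) g w"
  unfolding conv_def length_Cons by (subst sum.atMost_Suc_shift) simp

lemma conv_add_left: "conv (\<lambda>w. f w + g w) h w = conv f h w + conv g h w"
  by (simp add: conv_def distrib_right sum.distrib)

lemma conv_add_right: "conv f (\<lambda>w. g w + h w) w = conv f g w + conv f h w"
  by (simp add: conv_def distrib_left sum.distrib)

lemma conv_scale_left: "conv (\<lambda>w. c * f w) g w = c * conv f g w"
  by (simp add: conv_def sum_distrib_left mult.assoc)

lemma conv_scale_right: "conv f (\<lambda>w. c * g w) w = c * conv f g w"
  by (simp add: conv_def sum_distrib_left mult.left_commute)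

lemma conv_zero_left [simp]: "conv (\<lambda>w. 0) g w = 0"
  by (simp add: conv_def)

text \<open>The induction needs \<open>f\<close> arbitrary, because peeling off a letter
  \<open>x\<close> replaces \<open>f\<close> by its shift
  \<open>\<lambda>v. f (x # v)\<close>.\<close>

lemma conv_assoc: "conv (conv f g) h w = conv f (conv g h) w"
proof (induction w arbitrary: f)
  case (Cons x w)
  have "conv (conv f g) h (x # w)
      = f [] * g [] * h (x # w) + conv (\<lambda>v. f [] * g (x # v) + conv (\<lambda>v. f (x # v)) g v) h w"
    by (simp add: conv_Cons conv_Nil)
  also have "\<dots> = conv f (conv g h) (x # w)"
    by (simp add: conv_add_left conv_scale_left Cons.IH conv_Cons algebra_simps)
  finally show ?case .
qed (simp add: conv_Nil)

lemma conv_word: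
  "conv (word u) g w = (if take (length u) w = u then g (drop (length u) w) else 0)"
proof (induction u arbitrary: w)
  case Nil
  have "conv (word []) g (x # w) = g (x # w)" for x w
    by (simp add: conv_Cons word_def)
  then show ?case
    by (cases w) (auto simp: conv_Nil word_def)
next
  case (Cons x u)
  show ?case
  proof (cases w)
    case Nil
    then show ?thesis by (simp add: conv_Nil word_def)
  next
    case (Cons y v)
    have "(\<lambda>v. word (x # u) (y # v)) = (if x = y then word u else (\<lambda>_. 0))"
      by (auto simp: word_def fun_eq_iff)
    moreover have "word (x # u) [] = 0" by (simp add: word_def)
    ultimately show ?thesis using Cons.IH[of v] \<open>w = y # v\<close>
      by (auto simp: conv_Cons)
  qed
qed

lemma conv_word_word: "conv (word u) (word v) = word (u @ v)"
proof
  fix w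
  have "w = u @ v \<longleftrightarrow> take (length u) w = u \<and> drop (length u) w = v"
    by (metis append_eq_conv_conj)
  then show "conv (word u) (word v) w = word (u @ v) w"
    unfolding conv_word by (simp add: word_def)
qed

lemma conv_one_right: "conv f (word []) w = f w"
proof (induction w arbitrary: f)
  case (Cons x w)
  then show ?case by (simp add: conv_Cons word_def)
qed (simp add: conv_Nil word_def)

lemma free_algebra_simps:
  "carrier (free_algebra G) = {f. finite {w. f w \<noteq> 0} \<and> (\<forall>w. f w \<noteq> 0 \<longrightarrow> set w \<subseteq> G)}"
  "mult (free_algebra G) = conv" "one (free_algebra G) = word []"
  "zero (free_algebra G) = (\<lambda>w. 0)" "add (free_algebra G) = (\<lambda>f g w. f w + g w)"
  "smult (free_algebra G) = (\<lambda>c f w. c * f w)"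
  by (auto simp: free_algebra_def conv_def word_def fun_eq_iff)

lemma free_gen_word: "free_gen g = word [g]"
  by (simp add: free_gen_def word_def)

text \<open>The support of a product consists of concatenations of words from the two
  supports.\<close>

lemma conv_closed:
  assumes "f \<in> carrier (free_algebra G)" "g \<in> carrier (free_algebra G)"
  shows "conv f g \<in> carrier (free_algebra G)"
proof -
  have ex: "\<exists>k. f (take k w) \<noteq> 0 \<and> g (drop k w) \<noteq> 0" if "conv f g w \<noteq> 0" for w
  proof (rule ccontr)
    assume "\<nexists>k. f (take k w) \<noteq> 0 \<and> g (drop k w) \<noteq> 0"
    then have "conv f g w = 0" unfolding conv_def by (intro sum.neutral) auto
    then show False using that by simp
  qed
  have "{w. conv f g w \<noteq> 0} \<subseteq> (\<lambda>(u, v). u @ v) ` ({w. f w \<noteq> 0} \<times> {w. g w \<noteq> 0})"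
  proof
    fix w assume "w \<in> {w. conv f g w \<noteq> 0}"
    then obtain k where "f (take k w) \<noteq> 0" "g (drop k w) \<noteq> 0" using ex by blast
    then show "w \<in> (\<lambda>(u, v). u @ v) ` ({w. f w \<noteq> 0} \<times> {w. g w \<noteq> 0})"
      by (intro image_eqI[of _ _ "(take k w, drop k w)"]) auto
  qed
  then have "finite {w. conv f g w \<noteq> 0}"
    by (rule finite_subset) (use assms in \<open>auto simp: free_algebra_simps\<close>)
  moreover have "set w \<subseteq> G" if nz: "conv f g w \<noteq> 0" for w
  proof -
    obtain k where "f (take k w) \<noteq> 0" "g (drop k w) \<noteq> 0" using ex[OF nz] by blast
    then have "set (take k w) \<subseteq> G" "set (drop k w) \<subseteq> G"
      using assms by (auto simp: free_algebra_simps)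
    then show ?thesis by (metis Un_subset_iff append_take_drop_id set_append)
  qed
  ultimately show ?thesis by (simp add: free_algebra_simps)
qed

lemma add_closed_free_algebra:
  assumes "f \<in> carrier (free_algebra G)" "g \<in> carrier (free_algebra G)"
  shows "(\<lambda>w. f w + g w) \<in> carrier (free_algebra G)"
proof -
  have "finite {w. f w + g w \<noteq> 0}"
    by (rule finite_subset[of _ "{w. f w \<noteq> 0} \<union> {w. g w \<noteq> 0}"])
       (use assms in \<open>auto simp: free_algebra_simps\<close>)
  moreover have "f w \<noteq> 0 \<or> g w \<noteq> 0" if "f w + g w \<noteq> 0" for w
    using that by auto
  ultimately show ?thesis using assms unfolding free_algebra_simps by blast
qed

lemma scale_closed_free_algebra:
  assumes "f \<in> carrier (free_algebra G)"
  shows "(\<lambda>w. c * f w) \<in> carrier (free_algebra G)"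
proof -
  have "finite {w. c * f w \<noteq> 0}"
    by (rule finite_subset[of _ "{w. f w \<noteq> 0}"])
       (use assms in \<open>auto simp: free_algebra_simps\<close>)
  then show ?thesis using assms by (auto simp: free_algebra_simps)
qed

lemma word_closed: "set u \<subseteq> G \<Longrightarrow> word u \<in> carrier (free_algebra G)"
  by (auto simp: free_algebra_simps word_def)

lemma free_algebra_complex_algebra: "complex_algebra (free_algebra G)"
proof (intro complex_algebra.intro complex_algebra_axioms.intro ringI abelian_groupI monoidI)
  fix x assume x: "x \<in> carrier (free_algebra G)"
  show "\<exists>y\<in>carrier (free_algebra G). y \<oplus>\<^bsub>free_algebra G\<^esub> x = \<zero>\<^bsub>free_algebra G\<^esub>"
    using scale_closed_free_algebra[OF x, of "-1"]
    by (intro bexI[of _ "\<lambda>w. -1 * x w"]) (auto simp: free_algebra_simps(2-))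
qed (auto simp: free_algebra_simps(2-) conv_closed add_closed_free_algebra scale_closed_free_algebra
      word_closed conv_assoc conv_add_left conv_add_right conv_scale_left conv_scale_right
      conv_one_right conv_word algebra_simps fun_eq_iff, auto simp: free_algebra_simps)

lemma free_algebra_induct [consumes 1, case_names zero add word]:
  assumes "f \<in> carrier (free_algebra G)"
    and "P (\<lambda>w. 0)"
    and "\<And>f g. f \<in> carrier (free_algebra G) \<Longrightarrow> g \<in> carrier (free_algebra G) \<Longrightarrow> P f \<Longrightarrow> P g
      \<Longrightarrow> P (\<lambda>w. f w + g w)"
    and "\<And>c u. set u \<subseteq> G \<Longrightarrow> P (\<lambda>w. c * word u w)"
  shows "P f"
proof -
  \<comment> \<open>The induction runs over a finite set \<open>S\<close> containing the support;
    removing one word \<open>u\<close> is done by resetting \<open>f u\<close> to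
    \<open>0\<close>.\<close>
  have "P f" if "finite S" "{w. f w \<noteq> 0} \<subseteq> S" "f \<in> carrier (free_algebra G)" for f S
    using that
  proof (induction S arbitrary: f rule: finite_induct)
    case empty
    then have "f = (\<lambda>w. 0)" by auto
    then show ?case using assms(2) by simp
  next
    case (insert u S)
    show ?case
    proof (cases "f u = 0")
      case True
      then have "{w. f w \<noteq> 0} \<subseteq> S" using insert.prems(1) by auto
      then show ?thesis using insert.IH insert.prems(2) by simp
    next
      case False
      then have u: "set u \<subseteq> G" using insert.prems(2) unfolding free_algebra_simps by blast
      let ?g = "f(u := 0)"
      have sub: "?g w \<noteq> 0 \<Longrightarrow> f w \<noteq> 0" for w
        by (simp split: if_splits)
      then have "{w. ?g w \<noteq> 0} \<subseteq> {w. f w \<noteq> 0}" by blast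
      then have "finite {w. ?g w \<noteq> 0}"
        using insert.prems(2) unfolding free_algebra_simps by (auto intro: finite_subset)
      then have g: "?g \<in> carrier (free_algebra G)"
        using insert.prems(2) sub unfolding free_algebra_simps by blast
      have "{w. ?g w \<noteq> 0} \<subseteq> S"
        using insert.prems(1) by (auto split: if_splits)
      then have "P ?g" using g by (rule insert.IH)
      then have "P (\<lambda>w. ?g w + f u * word u w)"
        using u by (intro assms g scale_closed_free_algebra word_closed)
      moreover have "(\<lambda>w. ?g w + f u * word u w) = f"
        by (auto simp: word_def)
      ultimately show ?thesis by simp
    qed
  qed
  from this[OF _ subset_refl assms(1)] show ?thesis
    using assms(1) unfolding free_algebra_simps by blast
qed

text \<open>Uniqueness half of the universal property: a homomorphism is multiplicative on words and
  linear on their span.\<close>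

lemma free_algebra_hom_eq:
  assumes A: "complex_algebra A" and h: "h \<in> algebra_hom (free_algebra G) A"
    and k: "k \<in> algebra_hom (free_algebra G) A"
    and eq: "\<And>g. g \<in> G \<Longrightarrow> h (free_gen g) = k (free_gen g)"
    and f: "f \<in> carrier (free_algebra G)"
  shows "h f = k f"
proof -
  interpret F: complex_algebra "free_algebra G" by (rule free_algebra_complex_algebra)
  note [simp] = algebra_homD[OF h, unfolded free_algebra_simps(2-)]
    algebra_homD[OF k, unfolded free_algebra_simps(2-)]
  have words: "h (word u) = k (word u)" if "set u \<subseteq> G" for u
    using that
  proof (induction u)
    case (Cons x u)
    have "word (x # u) = conv (word [x]) (word u)" by (simp add: conv_word_word)
    then show ?case using Cons eq[of x] word_closed[of "[x]" G] word_closed[of u G]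
      by (simp add: free_gen_word)
  qed simp
  from f show ?thesis
  proof (induction rule: free_algebra_induct)
    case zero
    \<comment> \<open>Preservation of zero is not part of \<open>algebra_hom\<close>, so zero is
      written as the scalar \<open>0\<close> times the empty word.\<close>
    show ?case
      using algebra_homD(4)[OF h word_closed[of "[]"], of 0] algebra_homD(4)[OF k word_closed[of "[]"], of 0]
        words[of "[]"] by (simp add: free_algebra_simps(2-))
  next
    case (word c u)
    then show ?case using words word_closed[of u G] by simp
  qed auto
qed

definition word_prod :: "(complex, 'a) module \<Rightarrow> ('g \<Rightarrow> 'a) \<Rightarrow> 'g list \<Rightarrow> 'a" where
  "word_prod A y w = foldr (\<lambda>g x. y g \<otimes>\<^bsub>A\<^esub> x) w \<one>\<^bsub>A\<^esub>"

text \<open>Existence half of the universal property: the linear extension of products of the values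
  \<open>y g\<close>.\<close>

definition free_lift :: "(complex, 'a) module \<Rightarrow> ('g \<Rightarrow> 'a) \<Rightarrow> ('g list \<Rightarrow> complex) \<Rightarrow> 'a" where
  "free_lift A y f = (\<Oplus>\<^bsub>A\<^esub>w\<in>{w. f w \<noteq> 0}. f w \<odot>\<^bsub>A\<^esub> word_prod A y w)"

context complex_algebra
begin

context
  fixes G :: "'g set" and y :: "'g \<Rightarrow> 'a"
  assumes y: "\<And>g. g \<in> G \<Longrightarrow> y g \<in> carrier A"
begin

lemma word_prod_closed [simp]: "set w \<subseteq> G \<Longrightarrow> word_prod A y w \<in> carrier A"
  by (induction w) (auto simp: word_prod_def y)

lemma word_prod_append:
  "set u \<subseteq> G \<Longrightarrow> set v \<subseteq> G \<Longrightarrow> word_prod A y (u @ v) = word_prod A y u \<otimes> word_prod A y v"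
proof (induction u)
  case (Cons x u)
  then show ?case
    using word_prod_closed[of u] word_prod_closed[of v] y
    by (simp add: word_prod_def m_assoc)
qed (use word_prod_closed[of v] in \<open>simp add: word_prod_def\<close>)

text \<open>Lets elements with different supports be summed over one common finite set.\<close>

lemma free_lift_superset:
  assumes "finite S" "{w. f w \<noteq> 0} \<subseteq> S" "\<And>w. w \<in> S \<Longrightarrow> set w \<subseteq> G"
  shows "free_lift A y f = (\<Oplus>w\<in>S. f w \<odot> word_prod A y w)"
  unfolding free_lift_def using assms
  by (intro add.finprod_mono_neutral_cong_left) auto

lemma free_lift_closed [simp]: "f \<in> carrier (free_algebra G) \<Longrightarrow> free_lift A y f \<in> carrier A"
  unfolding free_lift_def by (rule finsum_closed) (auto simp: free_algebra_simps)

lemma free_lift_add: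
  assumes "f \<in> carrier (free_algebra G)" "g \<in> carrier (free_algebra G)"
  shows "free_lift A y (\<lambda>w. f w + g w) = free_lift A y f \<oplus> free_lift A y g"
proof -
  let ?S = "{w. f w \<noteq> 0} \<union> {w. g w \<noteq> 0}"
  have S: "finite ?S" "\<And>w. w \<in> ?S \<Longrightarrow> set w \<subseteq> G"
    using assms by (auto simp: free_algebra_simps)
  have "free_lift A y (\<lambda>w. f w + g w) = (\<Oplus>w\<in>?S. (f w + g w) \<odot> word_prod A y w)"
    "free_lift A y f = (\<Oplus>w\<in>?S. f w \<odot> word_prod A y w)"
    "free_lift A y g = (\<Oplus>w\<in>?S. g w \<odot> word_prod A y w)"
    by (rule free_lift_superset[OF S(1)]; use S(2) in auto)+
  moreover have "(\<Oplus>w\<in>?S. (f w + g w) \<odot> word_prod A y w)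
      = (\<Oplus>w\<in>?S. f w \<odot> word_prod A y w \<oplus> g w \<odot> word_prod A y w)"
    using S(2) by (intro add.finprod_cong') (auto simp: smult_add_left)
  moreover have "\<dots> = (\<Oplus>w\<in>?S. f w \<odot> word_prod A y w) \<oplus> (\<Oplus>w\<in>?S. g w \<odot> word_prod A y w)"
    using S(2) by (intro finsum_addf) auto
  ultimately show ?thesis by simp
qed

lemma free_lift_scale:
  assumes "f \<in> carrier (free_algebra G)"
  shows "free_lift A y (\<lambda>w. c * f w) = c \<odot> free_lift A y f"
proof -
  let ?S = "{w. f w \<noteq> 0}"
  have S: "finite ?S" "\<And>w. w \<in> ?S \<Longrightarrow> set w \<subseteq> G"
    using assms by (auto simp: free_algebra_simps)
  have "free_lift A y (\<lambda>w. c * f w) = (\<Oplus>w\<in>?S. (c * f w) \<odot> word_prod A y w)"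
    by (rule free_lift_superset[OF S(1)]) (use S(2) in auto)
  also have "\<dots> = (\<Oplus>w\<in>?S. c \<odot> (f w \<odot> word_prod A y w))"
    using S(2) by (intro add.finprod_cong') (auto simp: smult_smult)
  finally show ?thesis
    unfolding free_lift_def using S(2) by (subst smult_finsum) auto
qed

lemma free_lift_word:
  assumes "set u \<subseteq> G" shows "free_lift A y (word u) = word_prod A y u"
proof -
  have "free_lift A y (word u) = (\<Oplus>w\<in>{u}. word u w \<odot> word_prod A y w)"
    using assms by (intro free_lift_superset) (auto simp: word_def)
  then show ?thesis using assms by (simp add: word_def)
qed

lemma free_lift_zero: "free_lift A y (\<lambda>w. 0) = \<zero>"
  by (simp add: free_lift_def)

text \<open>Both sides are bilinear, so the claim reduces to words, first in the right factor and
  then in the left one.\<close>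

lemma free_lift_mult:
  assumes f: "f \<in> carrier (free_algebra G)" and g: "g \<in> carrier (free_algebra G)"
  shows "free_lift A y (conv f g) = free_lift A y f \<otimes> free_lift A y g"
proof -
  have words: "free_lift A y (conv (word u) g) = word_prod A y u \<otimes> free_lift A y g"
    if u: "set u \<subseteq> G" for u
    using g
  proof (induction rule: free_algebra_induct)
    case zero
    have "conv (word u) (\<lambda>w. 0) = (\<lambda>w. 0)" by (auto simp: conv_def)
    then show ?case using u by (simp add: free_lift_zero)
  next
    case (add f g)
    have "conv (word u) (\<lambda>w. f w + g w) = (\<lambda>w. conv (word u) f w + conv (word u) g w)"
      by (auto simp: conv_add_right)
    then show ?case using u add
      by (simp add: free_lift_add conv_closed word_closed r_distr)
  next
    case (word c v)
    have "conv (word u) (\<lambda>w. c * word v w) = (\<lambda>w. c * word (u @ v) w)"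
      by (auto simp: conv_scale_right conv_word_word)
    then show ?case using u word
      by (simp add: free_lift_scale word_closed free_lift_word word_prod_append smult_mult_right)
  qed
  from f show ?thesis
  proof (induction rule: free_algebra_induct)
    case zero
    have "conv (\<lambda>w. 0) g = (\<lambda>w. 0)" by auto
    then show ?case using g by (simp add: free_lift_zero)
  next
    case (add f h)
    have "conv (\<lambda>w. f w + h w) g = (\<lambda>w. conv f g w + conv h g w)"
      by (auto simp: conv_add_left)
    then show ?case using g add
      by (simp add: free_lift_add conv_closed l_distr)
  next
    case (word c u)
    have "conv (\<lambda>w. c * word u w) g = (\<lambda>w. c * conv (word u) g w)"
      by (auto simp: conv_scale_left)
    then show ?case using g word
      by (simp add: free_lift_scale conv_closed word_closed words free_lift_word smult_mult_left)
  qed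
qed

lemma free_lift_hom: "free_lift A y \<in> algebra_hom (free_algebra G) A"
proof -
  have "free_lift A y (word []) = \<one>"
    using free_lift_word[of "[]"] by (simp add: word_prod_def)
  then show ?thesis
    unfolding algebra_hom_def
    by (auto intro!: ring_hom_memI simp: free_algebra_simps(2-) free_lift_mult free_lift_add free_lift_scale)
qed

end

end

section \<open>The ring of meromorphic functions\<close>

lemma mero_rep_ring_simps:
  "carrier (mero_rep_ring C) = mero_rep C"
  "mult (mero_rep_ring C) = (\<lambda>f g x. f x * g x)" "one (mero_rep_ring C) = (\<lambda>_. 1)"
  "zero (mero_rep_ring C) = (\<lambda>_. 0)" "add (mero_rep_ring C) = (\<lambda>f g x. f x + g x)"
  by (auto simp: mero_rep_ring_def)

text \<open>Sums and products stay quotients of polynomials because two nonempty open sets of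
  definition meet in an irreducible set.\<close>

lemma mero_rep_ring:
  assumes "irreducible_set C" shows "ring (mero_rep_ring C)"
proof (intro ringI abelian_groupI monoidI)
  fix f assume "f \<in> carrier (mero_rep_ring C)"
  then have "(\<lambda>x. -1 * f x) \<in> mero_rep C"
    using mero_rep_mult[OF assms mero_rep_const[OF assms, of "-1"]] by (simp add: mero_rep_ring_simps)
  then show "\<exists>g\<in>carrier (mero_rep_ring C). g \<oplus>\<^bsub>mero_rep_ring C\<^esub> f = \<zero>\<^bsub>mero_rep_ring C\<^esub>"
    by (intro bexI[of _ "\<lambda>x. -1 * f x"]) (auto simp: mero_rep_ring_simps)
qed (auto simp: mero_rep_ring_simps assms mero_rep_add mero_rep_mult mero_rep_const algebra_simps)

lemma mero_rep_diff:
  assumes "irreducible_set C" "f \<in> mero_rep C" "g \<in> mero_rep C"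
  shows "(\<lambda>x. f x - g x) \<in> mero_rep C"
  using mero_rep_add[OF assms(1,2) mero_rep_mult[OF assms(1) mero_rep_const[OF assms(1), of "-1"] assms(3)]]
  by simp

lemma mero_null_add:
  assumes "irreducible_set C" "f \<in> mero_null C" "g \<in> mero_null C"
  shows "(\<lambda>x. f x + g x) \<in> mero_null C"
proof -
  have "generic C (\<lambda>x. f x = 0 \<and> g x = 0)"
    using assms by (intro generic_conj) (auto simp: mero_null_iff)
  then have "generic C (\<lambda>x. f x + g x = 0)" by (rule generic_mono) simp
  then show ?thesis using assms mero_rep_add[OF assms(1), of f g] by (simp add: mero_null_iff)
qed

lemma mero_null_mult:
  assumes "irreducible_set C" "f \<in> mero_null C" "g \<in> mero_rep C"
  shows "(\<lambda>x. g x * f x) \<in> mero_null C"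
proof -
  have "generic C (\<lambda>x. f x = 0)" using assms by (simp add: mero_null_iff)
  then have "generic C (\<lambda>x. g x * f x = 0)" by (rule generic_mono) simp
  moreover have "(\<lambda>x. g x * f x) \<in> mero_rep C"
    using assms by (intro mero_rep_mult) (auto simp: mero_null_iff)
  ultimately show ?thesis unfolding mero_null_iff by blast
qed

lemma mero_null_ideal:
  assumes "irreducible_set C" shows "ideal (mero_null C) (mero_rep_ring C)"
proof -
  interpret ring "mero_rep_ring C" using assms by (rule mero_rep_ring)
  have sub: "mero_null C \<subseteq> mero_rep C" by (auto simp: mero_null_iff)
  have zero: "(\<lambda>_. 0) \<in> mero_null C"
    using generic_True[OF assms, of "\<lambda>_. (0::complex) = 0"] mero_rep_const[OF assms, of 0]
    by (simp add: mero_null_iff)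
  show ?thesis
  proof (rule idealI)
    show "subgroup (mero_null C) (add_monoid (mero_rep_ring C))"
    proof (rule add.subgroupI)
      fix f assume f: "f \<in> mero_null C"
      then have f': "f \<in> mero_rep C" using sub by blast
      have neg: "(\<lambda>x. -1 * f x) \<in> mero_null C"
        using mero_null_mult[OF assms f mero_rep_const[OF assms, of "-1"]] by simp
      have "\<ominus>\<^bsub>mero_rep_ring C\<^esub> f = (\<lambda>x. -1 * f x)"
        using f' neg sub by (intro minus_equality) (auto simp: mero_rep_ring_simps)
      then show "\<ominus>\<^bsub>mero_rep_ring C\<^esub> f \<in> mero_null C" using neg by simp
    qed (use sub zero mero_null_add[OF assms] in \<open>auto simp: mero_rep_ring_simps\<close>)
    fix f g assume "f \<in> mero_null C" "g \<in> carrier (mero_rep_ring C)"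
    then have "(\<lambda>x. g x * f x) \<in> mero_null C"
      using mero_null_mult[OF assms] by (simp add: mero_rep_ring_simps)
    then show "g \<otimes>\<^bsub>mero_rep_ring C\<^esub> f \<in> mero_null C" "f \<otimes>\<^bsub>mero_rep_ring C\<^esub> g \<in> mero_null C"
      by (simp_all add: mero_rep_ring_simps mult.commute)
  qed (rule mero_rep_ring[OF assms])
qed

lemma mero_class_ops:
  assumes "irreducible_set C" "f \<in> mero_rep C" "g \<in> mero_rep C"
  shows "mero_class C f \<in> carrier (mero_ring C)"
    and "mero_class C f \<oplus>\<^bsub>mero_ring C\<^esub> mero_class C g = mero_class C (\<lambda>x. f x + g x)"
    and "mero_class C f \<otimes>\<^bsub>mero_ring C\<^esub> mero_class C g = mero_class C (\<lambda>x. f x * g x)"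
proof -
  have hom: "mero_class C \<in> ring_hom (mero_rep_ring C) (mero_ring C)"
    using ideal.rcos_ring_hom[OF mero_null_ideal[OF assms(1)]]
    by (simp add: mero_ring_def mero_class_def[abs_def])
  show "mero_class C f \<in> carrier (mero_ring C)"
    "mero_class C f \<oplus>\<^bsub>mero_ring C\<^esub> mero_class C g = mero_class C (\<lambda>x. f x + g x)"
    "mero_class C f \<otimes>\<^bsub>mero_ring C\<^esub> mero_class C g = mero_class C (\<lambda>x. f x * g x)"
    using ring_hom_closed[OF hom, of f] ring_hom_add[OF hom, of f g] ring_hom_mult[OF hom, of f g] assms
    by (simp_all add: mero_rep_ring_simps)
qed

text \<open>The difference vanishes generically and is therefore null: identities of meromorphic
  functions need checking only on a nonempty open set.\<close>

lemma mero_class_cong: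
  assumes "irreducible_set C" "f \<in> mero_rep C" "g \<in> mero_rep C" "generic C (\<lambda>x. f x = g x)"
  shows "mero_class C f = mero_class C g"
proof -
  interpret ring "mero_rep_ring C" using assms(1) by (rule mero_rep_ring)
  interpret I: ideal "mero_null C" "mero_rep_ring C" using assms(1) by (rule mero_null_ideal)
  have "generic C (\<lambda>x. f x - g x = 0)" using assms(4) by (rule generic_mono) simp
  then have "(\<lambda>x. f x - g x) \<in> mero_null C"
    using mero_rep_diff[OF assms(1-3)] by (simp add: mero_null_iff)
  then have "f \<in> mero_null C +>\<^bsub>mero_rep_ring C\<^esub> g"
    by (auto simp: a_r_coset_def r_coset_def mero_rep_ring_simps intro!: bexI[of _ "\<lambda>x. f x - g x"])
  then show ?thesis
    unfolding mero_class_def using assms(3) I.a_subgroup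
    by (intro a_repr_independence[symmetric]) (auto simp: mero_rep_ring_simps)
qed

section \<open>The diagonal, and tensors of degree one and two\<close>

text \<open>Distinct points have a nonzero 2 by 2 minor, and one involving a nonzero coordinate
  \<open>k\<close> of \<open>Z\<close> can be found: otherwise the representatives would be
  proportional with factor \<open>rep Z' $ k / rep Z $ k\<close>.\<close>

lemma near_distinct:
  assumes "x \<in> C" "fst x \<noteq> snd x" shows "near C x (\<lambda>y. fst y \<noteq> snd y)"
proof -
  obtain Z Z' where x: "x = (Z, Z')" by (cases x)
  obtain k where k: "rep Z $ k \<noteq> 0"
    using rep_in_reps[of Z] by (auto simp: reps_def vec_eq_iff)
  have "\<exists>i. rep Z $ k * rep Z' $ i - rep Z $ i * rep Z' $ k \<noteq> 0"
  proof (rule ccontr)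
    assume "\<not> ?thesis"
    then have minors: "rep Z $ k * rep Z' $ i = rep Z $ i * rep Z' $ k" for i by auto
    define c where "c = rep Z' $ k / rep Z $ k"
    have "rep Z' $ i = c * rep Z $ i" for i
      using k minors[of i] by (simp add: c_def field_simps)
    then have eq: "rep Z' = c *s rep Z" by (simp add: vec_eq_iff)
    obtain v where v: "Rep_proj Z = range (\<lambda>c. c *s v)" using Rep_proj[of Z] by blast
    then obtain a where "rep Z = a *s v" using rep_in_reps[of Z] by (auto simp: reps_def)
    with eq have "rep Z' = (c * a) *s v" by (simp add: vector_smult_assoc)
    then have "rep Z' \<in> Rep_proj Z" unfolding v by blast
    then have "rep Z' \<in> reps Z" using rep_in_reps[of Z'] by (simp add: reps_def)
    then show False using proj_eqI[OF rep_in_reps[of Z']] assms x by auto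
  qed
  then obtain i where i: "rep Z $ k * rep Z' $ i - rep Z $ i * rep Z' $ k \<noteq> 0" by blast
  let ?q = "\<lambda>z z'. z $ k * z' $ i + (-1) * (z $ i * z' $ k)"
  have "biform (1 + 0) (0 + 1) ?q"
    by (intro biform_add biform_cmult biform_mult biform_nth1 biform_nth2)
  then have "near C x (\<lambda>y. ev ?q y \<noteq> 0)"
    using assms i by (intro near_biform) (auto simp: ev_def x)
  then show ?thesis by (rule near_mono) (auto simp: ev_def)
qed

text \<open>Division by \<open>0\<close> gives \<open>0\<close> on both sides, so the formulas for
  the coefficients of the squares of \<open>W\<close> and \<open>W'\<close> derived from this hold
  at every point.\<close>

lemma bil_quotient_sum:
  "(\<Sum>p\<in>UNIV. \<omega> $ p * (u $ fst p / a * (v $ snd p / b))) = bil \<omega> u v / (a * b)"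
proof -
  have "bil \<omega> u v = (\<Sum>p\<in>UNIV. \<omega> $ p * u $ fst p * v $ snd p)"
    unfolding bil_def UNIV_Times_UNIV[symmetric]
    by (simp add: sum.cartesian_product case_prod_beta)
  then show ?thesis
    by (simp add: sum_divide_distrib divide_simps mult_ac)
qed

lemma bil_sym: "symmetric_tensor Q \<Longrightarrow> bil Q u v = bil Q v u"
  unfolding bil_def symmetric_tensor_def
  by (subst sum.swap) (simp add: mult_ac)

lemma tensor1_axis: "tensor1_in (axis i 1) = free_gen i"
  by (auto simp: tensor1_in_def free_gen_def axis_def fun_eq_iff split: list.splits)

lemma tensor1_support: "{w. tensor1_in Y w \<noteq> 0} \<subseteq> range (\<lambda>i. [i])"
proof
  fix w assume "w \<in> {w. tensor1_in Y w \<noteq> 0}"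
  then obtain i where "w = [i]"
    by (cases w; cases "tl w") (auto simp: tensor1_in_def)
  then show "w \<in> range (\<lambda>i. [i])" by blast
qed

lemma tensor2_support: "{w. tensor2_in \<omega> w \<noteq> 0} \<subseteq> range (\<lambda>p. [fst p, snd p])"
proof
  fix w assume "w \<in> {w. tensor2_in \<omega> w \<noteq> 0}"
  then obtain i j where "w = [i, j]"
    by (cases w; cases "tl w"; cases "tl (tl w)") (auto simp: tensor2_in_def)
  then show "w \<in> range (\<lambda>p. [fst p, snd p])" by (intro range_eqI[of _ _ "(i, j)"]) simp
qed

lemma tensor1_closed: "tensor1_in Y \<in> carrier (free_algebra UNIV)"
  using finite_subset[OF tensor1_support] by (simp add: free_algebra_simps)

lemma tensor2_closed: "tensor2_in \<omega> \<in> carrier (free_algebra UNIV)"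
  using finite_subset[OF tensor2_support] by (simp add: free_algebra_simps)

context complex_algebra
begin

lemma free_lift_tensor1:
  assumes "\<And>i. y i \<in> carrier A"
  shows "free_lift A y (tensor1_in Y) = (\<Oplus>i\<in>UNIV. Y $ i \<odot> y i)"
proof -
  have "free_lift A y (tensor1_in Y)
      = (\<Oplus>w\<in>range (\<lambda>i. [i]). tensor1_in Y w \<odot> word_prod A y w)"
    using assms by (intro free_lift_superset[of UNIV] tensor1_support) auto
  also have "\<dots> = (\<Oplus>i\<in>UNIV. tensor1_in Y [i] \<odot> word_prod A y [i])"
    using assms by (subst add.finprod_reindex) (auto simp: inj_on_def word_prod_def)
  finally show ?thesis
    using assms by (simp add: tensor1_in_def word_prod_def cong: add.finprod_cong)
qed

lemma free_lift_tensor2: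
  assumes "\<And>i. y i \<in> carrier A"
  shows "free_lift A y (tensor2_in \<omega>) = (\<Oplus>p\<in>UNIV. \<omega> $ p \<odot> (y (fst p) \<otimes> y (snd p)))"
proof -
  have "free_lift A y (tensor2_in \<omega>)
      = (\<Oplus>w\<in>range (\<lambda>p. [fst p, snd p]). tensor2_in \<omega> w \<odot> word_prod A y w)"
    using assms by (intro free_lift_superset[of UNIV] tensor2_support) auto
  also have "\<dots> = (\<Oplus>p\<in>UNIV. tensor2_in \<omega> [fst p, snd p] \<odot> word_prod A y [fst p, snd p])"
    using assms by (subst add.finprod_reindex) (auto simp: inj_on_def word_prod_def)
  finally show ?thesis
    using assms by (simp add: tensor2_in_def word_prod_def cong: add.finprod_cong)
qed

end

section \<open>The crossed product\<close>

locale central_component =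
  fixes R :: "'n::finite tensor2 set" and E :: "'n proj set" and \<sigma> :: "'n proj \<Rightarrow> 'n proj"
    and C :: "('n proj \<times> 'n proj) set" and Q :: "'n tensor2" and L L' :: "complex ^ 'n"
  assumes char: "characteristic_variety R E \<sigma>"
    and component: "component_of (E \<times> E) C"
    and twist_invariant: "twist E \<sigma> ` C = C"
    and symmetric: "symmetric_tensor Q"
    and central: "central_on R E \<sigma> C Q"
    and Q_nonzero: "\<not> vanishes_on C (bil Q)"
    and LL'_nonzero: "\<not> vanishes_on C (\<lambda>z z'. lin L z * lin L' z')"
begin

abbreviation \<sigma>' :: "'n proj \<Rightarrow> 'n proj" where "\<sigma>' \<equiv> inv_into E \<sigma>"
abbreviation \<tau> :: "'n proj \<times> 'n proj \<Rightarrow> 'n proj \<times> 'n proj" where "\<tau> \<equiv> map_prod \<sigma> \<sigma>'"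
abbreviation \<tau>' :: "'n proj \<times> 'n proj \<Rightarrow> 'n proj \<times> 'n proj" where "\<tau>' \<equiv> map_prod \<sigma>' \<sigma>"

lemma irreducible: "irreducible_set C" and C_subset: "C \<subseteq> E \<times> E"
  using component by (auto simp: component_of_def)

lemma bij: "bij_betw \<sigma> E E" and regular: "regular_map_on E \<sigma>" "regular_map_on E \<sigma>'"
  using char by (auto simp: characteristic_variety_def variety_automorphism_def)

lemma twist_eq: "twist E \<sigma> = \<tau>" "twist_inv E \<sigma> = \<tau>'"
  by (auto simp: twist_def twist_inv_def)

lemma \<sigma>_closed: "Z \<in> E \<Longrightarrow> \<sigma> Z \<in> E" "Z \<in> E \<Longrightarrow> \<sigma>' Z \<in> E"
  using bij bij_betw_inv_into[OF bij] by (auto dest: bij_betwE)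

lemma \<sigma>_inverse: "Z \<in> E \<Longrightarrow> \<sigma>' (\<sigma> Z) = Z" "Z \<in> E \<Longrightarrow> \<sigma> (\<sigma>' Z) = Z"
  using bij by (auto simp: bij_betw_inv_into_left bij_betw_inv_into_right)

lemma \<tau>_inverse: assumes "x \<in> C" shows "\<tau>' (\<tau> x) = x" "\<tau> (\<tau>' x) = x"
  using assms C_subset by (cases x; auto simp: \<sigma>_inverse)+

lemma \<tau>_image: "\<tau> ` C = C" "\<tau>' ` C = C"
proof -
  show "\<tau> ` C = C" using twist_invariant by (simp add: twist_eq)
  then have "\<tau>' ` C = \<tau>' ` \<tau> ` C" by simp
  also have "\<dots> = C" by (simp add: image_image \<tau>_inverse del: map_prod_simp)
  finally show "\<tau>' ` C = C" .
qed

sublocale \<tau>: invariant_component E C \<sigma> \<sigma>'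
  by unfold_locales (rule C_subset regular \<tau>_image)+

sublocale \<tau>': invariant_component E C \<sigma>' \<sigma>
  by unfold_locales (rule C_subset regular \<tau>_image)+

abbreviation \<pi> :: "'n proj \<times> 'n proj \<Rightarrow> complex" where "\<pi> \<equiv> cq_pi Q L L'"

lemma lin_nonzero: "\<not> vanishes_on C (\<lambda>z z'. lin L z)" "\<not> vanishes_on C (\<lambda>z z'. lin L' z')"
  using LL'_nonzero unfolding vanishes_on_def by auto

lemma \<pi>_mero: "\<pi> \<in> mero_rep C"
  unfolding cq_pi_def
proof (rule mero_rep_ratio)
  show "biform 1 1 (\<lambda>z z'. lin L z * lin L' z')"
    using biform_mult[OF biform_lin1[of L] biform_lin2[of L']] by simp
qed (rule biform_bil Q_nonzero)+

lemmas mero_const = mero_rep_const[OF irreducible]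
lemmas mero_add = mero_rep_add[OF irreducible]
lemmas mero_mult = mero_rep_mult[OF irreducible]
lemmas mero_sum = mero_rep_sum[OF irreducible]
lemmas mero_\<tau> = \<tau>.mero_rep_comp \<tau>'.mero_rep_comp

abbreviation F where "F \<equiv> cq_free C"
abbreviation I where "I \<equiv> cq_ideal E \<sigma> C Q L L'"
abbreviation B where "B \<equiv> CQ E \<sigma> C Q L L'"
abbreviation \<gamma> where "\<gamma> \<equiv> \<lambda>f. free_gen (Fun (mero_class C f))"

lemma F_algebra: "complex_algebra F"
  unfolding cq_free_def by (rule free_algebra_complex_algebra)

sublocale F: complex_algebra F by (rule F_algebra)

lemma F_gens:
  "free_gen W \<in> carrier F" "free_gen W' \<in> carrier F"
  "r \<in> carrier (mero_ring C) \<Longrightarrow> free_gen (Fun r) \<in> carrier F"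
  unfolding cq_free_def free_gen_word by (auto intro!: word_closed)

lemma mero_class_closed: "f \<in> mero_rep C \<Longrightarrow> mero_class C f \<in> carrier (mero_ring C)"
  by (rule mero_class_ops[OF irreducible])

lemma \<gamma>_closed: "f \<in> mero_rep C \<Longrightarrow> \<gamma> f \<in> carrier F"
  by (rule F_gens) (rule mero_class_closed)

lemma mero_ring_closed:
  assumes "r \<in> carrier (mero_ring C)" "s \<in> carrier (mero_ring C)"
  shows "r \<oplus>\<^bsub>mero_ring C\<^esub> s \<in> carrier (mero_ring C)" "r \<otimes>\<^bsub>mero_ring C\<^esub> s \<in> carrier (mero_ring C)"
proof -
  interpret M: ring "mero_ring C"
    unfolding mero_ring_def by (rule ideal.quotient_is_ring[OF mero_null_ideal[OF irreducible]])
  show "r \<oplus>\<^bsub>mero_ring C\<^esub> s \<in> carrier (mero_ring C)" "r \<otimes>\<^bsub>mero_ring C\<^esub> s \<in> carrier (mero_ring C)"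
    using assms by auto
qed

lemma twisted_\<pi>: "(\<lambda>(Z, Z'). \<pi> (\<sigma>' Z, \<sigma> Z')) = (\<lambda>x. \<pi> (\<tau>' x))"
  by (auto simp: fun_eq_iff)

lemma relators:
  shows "r \<in> carrier (mero_ring C) \<Longrightarrow> s \<in> carrier (mero_ring C) \<Longrightarrow>
      free_gen (Fun (r \<oplus>\<^bsub>mero_ring C\<^esub> s)) \<ominus>\<^bsub>F\<^esub> (free_gen (Fun r) \<oplus>\<^bsub>F\<^esub> free_gen (Fun s)) \<in> cq_relators E \<sigma> C Q L L'"
    and "r \<in> carrier (mero_ring C) \<Longrightarrow> s \<in> carrier (mero_ring C) \<Longrightarrow>
      free_gen (Fun (r \<otimes>\<^bsub>mero_ring C\<^esub> s)) \<ominus>\<^bsub>F\<^esub> (free_gen (Fun r) \<otimes>\<^bsub>F\<^esub> free_gen (Fun s)) \<in> cq_relators E \<sigma> C Q L L'"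
    and "\<gamma> (\<lambda>_. c) \<ominus>\<^bsub>F\<^esub> (c \<odot>\<^bsub>F\<^esub> \<one>\<^bsub>F\<^esub>) \<in> cq_relators E \<sigma> C Q L L'"
    and "f \<in> mero_rep C \<Longrightarrow>
      (free_gen W \<otimes>\<^bsub>F\<^esub> \<gamma> f) \<ominus>\<^bsub>F\<^esub> (\<gamma> (\<lambda>x. f (\<tau> x)) \<otimes>\<^bsub>F\<^esub> free_gen W) \<in> cq_relators E \<sigma> C Q L L'"
    and "f \<in> mero_rep C \<Longrightarrow>
      (free_gen W' \<otimes>\<^bsub>F\<^esub> \<gamma> f) \<ominus>\<^bsub>F\<^esub> (\<gamma> (\<lambda>x. f (\<tau>' x)) \<otimes>\<^bsub>F\<^esub> free_gen W') \<in> cq_relators E \<sigma> C Q L L'"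
    and "(free_gen W \<otimes>\<^bsub>F\<^esub> free_gen W') \<ominus>\<^bsub>F\<^esub> \<gamma> \<pi> \<in> cq_relators E \<sigma> C Q L L'"
    and "(free_gen W' \<otimes>\<^bsub>F\<^esub> free_gen W) \<ominus>\<^bsub>F\<^esub> \<gamma> (\<lambda>x. \<pi> (\<tau>' x)) \<in> cq_relators E \<sigma> C Q L L'"
  unfolding cq_relators_def Let_def twist_eq comp_def twisted_\<pi> by blast+

lemma relators_closed: "cq_relators E \<sigma> C Q L L' \<subseteq> carrier F"
  unfolding cq_relators_def Let_def twist_eq comp_def twisted_\<pi>
  by (safe intro!: F.minus_closed F.a_closed F.m_closed F.smult_closed F.one_closed
      F_gens mero_ring_closed mero_class_closed mero_const mero_\<tau> \<pi>_mero)

sublocale Q: algebra_ideal F I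
  unfolding cq_ideal_def
  by (rule algebra_ideal.intro[OF F_algebra F.genideal_ideal[OF relators_closed]])

lemma B_algebra: "complex_algebra B"
  unfolding CQ_def by (rule Q.quot_complex_algebra)

sublocale B: complex_algebra B by (rule B_algebra)

text \<open>Each relator is a difference lying in the ideal; this is how the presentation is turned
  into identities in \<open>B\<close>.\<close>

lemma coset_eqI:
  assumes "x \<ominus>\<^bsub>F\<^esub> y \<in> cq_relators E \<sigma> C Q L L'" "x \<in> carrier F" "y \<in> carrier F"
  shows "I +>\<^bsub>F\<^esub> x = I +>\<^bsub>F\<^esub> y"
proof -
  have "x \<ominus>\<^bsub>F\<^esub> y \<in> I"
    using F.genideal_self[OF relators_closed] assms(1) unfolding cq_ideal_def by blast
  with assms show ?thesis by (simp add: Q.coset_eq_iff)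
qed

lemma coset_B:
  "x \<in> carrier F \<Longrightarrow> I +>\<^bsub>F\<^esub> x \<in> carrier B"
  "x \<in> carrier F \<Longrightarrow> y \<in> carrier F \<Longrightarrow> I +>\<^bsub>F\<^esub> (x \<oplus>\<^bsub>F\<^esub> y) = (I +>\<^bsub>F\<^esub> x) \<oplus>\<^bsub>B\<^esub> (I +>\<^bsub>F\<^esub> y)"
  "x \<in> carrier F \<Longrightarrow> y \<in> carrier F \<Longrightarrow> I +>\<^bsub>F\<^esub> (x \<otimes>\<^bsub>F\<^esub> y) = (I +>\<^bsub>F\<^esub> x) \<otimes>\<^bsub>B\<^esub> (I +>\<^bsub>F\<^esub> y)"
  "x \<in> carrier F \<Longrightarrow> I +>\<^bsub>F\<^esub> (c \<odot>\<^bsub>F\<^esub> x) = c \<odot>\<^bsub>B\<^esub> (I +>\<^bsub>F\<^esub> x)"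
  "I +>\<^bsub>F\<^esub> \<one>\<^bsub>F\<^esub> = \<one>\<^bsub>B\<^esub>"
  unfolding CQ_def
  by (simp_all add: carrier_quot_algebra Q.coset_ops Q.coset_smult Q.coset_consts)

abbreviation u where "u \<equiv> cq_elem E \<sigma> C Q L L' W"
abbreviation u' where "u' \<equiv> cq_elem E \<sigma> C Q L L' W'"
text \<open>Takes a representative rather than a class, so that coefficients can be computed
  pointwise; \<open>\<phi>_cong\<close> allows changes outside a nonempty open set.\<close>

definition \<phi> where "\<phi> f = cq_elem E \<sigma> C Q L L' (Fun (mero_class C f))"

lemma u_closed [simp]: "u \<in> carrier B" "u' \<in> carrier B"
  unfolding cq_elem_def by (rule coset_B F_gens)+

lemma \<phi>_closed [simp]: "f \<in> mero_rep C \<Longrightarrow> \<phi> f \<in> carrier B"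
  unfolding \<phi>_def cq_elem_def by (rule coset_B \<gamma>_closed)+

lemma \<phi>_add:
  assumes "f \<in> mero_rep C" "g \<in> mero_rep C"
  shows "\<phi> (\<lambda>x. f x + g x) = \<phi> f \<oplus>\<^bsub>B\<^esub> \<phi> g"
proof -
  note ops = mero_class_ops[OF irreducible assms]
  have "I +>\<^bsub>F\<^esub> \<gamma> (\<lambda>x. f x + g x) = I +>\<^bsub>F\<^esub> (\<gamma> f \<oplus>\<^bsub>F\<^esub> \<gamma> g)"
    using relators(1)[OF mero_class_closed[OF assms(1)] mero_class_closed[OF assms(2)]] unfolding ops
    by (rule coset_eqI) (use assms in \<open>auto intro!: \<gamma>_closed mero_add\<close>)
  then show ?thesis using assms by (simp add: \<phi>_def cq_elem_def coset_B \<gamma>_closed)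
qed

lemma \<phi>_mult:
  assumes "f \<in> mero_rep C" "g \<in> mero_rep C"
  shows "\<phi> (\<lambda>x. f x * g x) = \<phi> f \<otimes>\<^bsub>B\<^esub> \<phi> g"
proof -
  note ops = mero_class_ops[OF irreducible assms]
  have "I +>\<^bsub>F\<^esub> \<gamma> (\<lambda>x. f x * g x) = I +>\<^bsub>F\<^esub> (\<gamma> f \<otimes>\<^bsub>F\<^esub> \<gamma> g)"
    using relators(2)[OF mero_class_closed[OF assms(1)] mero_class_closed[OF assms(2)]] unfolding ops
    by (rule coset_eqI) (use assms in \<open>auto intro!: \<gamma>_closed mero_mult\<close>)
  then show ?thesis using assms by (simp add: \<phi>_def cq_elem_def coset_B \<gamma>_closed)
qed

lemma \<phi>_const: "\<phi> (\<lambda>_. c) = c \<odot>\<^bsub>B\<^esub> \<one>\<^bsub>B\<^esub>"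
proof -
  have "I +>\<^bsub>F\<^esub> \<gamma> (\<lambda>_. c) = I +>\<^bsub>F\<^esub> (c \<odot>\<^bsub>F\<^esub> \<one>\<^bsub>F\<^esub>)"
    using relators(3) by (rule coset_eqI) (auto intro!: \<gamma>_closed mero_const)
  then show ?thesis by (simp add: \<phi>_def cq_elem_def coset_B)
qed

lemma \<phi>_cong:
  assumes "f \<in> mero_rep C" "g \<in> mero_rep C" "generic C (\<lambda>x. f x = g x)" shows "\<phi> f = \<phi> g"
  using mero_class_cong[OF irreducible assms] by (simp add: \<phi>_def)

lemma \<phi>_scale:
  assumes "f \<in> mero_rep C" shows "\<phi> (\<lambda>x. c * f x) = c \<odot>\<^bsub>B\<^esub> \<phi> f"
  using \<phi>_mult[OF mero_const assms, of c] assms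
  by (simp add: \<phi>_const B.smult_mult_left)

lemma u_\<phi>:
  assumes "f \<in> mero_rep C" shows "u \<otimes>\<^bsub>B\<^esub> \<phi> f = \<phi> (\<lambda>x. f (\<tau> x)) \<otimes>\<^bsub>B\<^esub> u"
proof -
  have "I +>\<^bsub>F\<^esub> (free_gen W \<otimes>\<^bsub>F\<^esub> \<gamma> f) = I +>\<^bsub>F\<^esub> (\<gamma> (\<lambda>x. f (\<tau> x)) \<otimes>\<^bsub>F\<^esub> free_gen W)"
    using relators(4)[OF assms]
    by (rule coset_eqI) (use assms in \<open>auto intro!: \<gamma>_closed mero_\<tau> F_gens(1,2)\<close>)
  then show ?thesis using assms F_gens \<gamma>_closed[OF mero_\<tau>(1)[OF assms]]
    by (simp add: \<phi>_def cq_elem_def coset_B \<gamma>_closed)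
qed

lemma u'_\<phi>:
  assumes "f \<in> mero_rep C" shows "u' \<otimes>\<^bsub>B\<^esub> \<phi> f = \<phi> (\<lambda>x. f (\<tau>' x)) \<otimes>\<^bsub>B\<^esub> u'"
proof -
  have "I +>\<^bsub>F\<^esub> (free_gen W' \<otimes>\<^bsub>F\<^esub> \<gamma> f) = I +>\<^bsub>F\<^esub> (\<gamma> (\<lambda>x. f (\<tau>' x)) \<otimes>\<^bsub>F\<^esub> free_gen W')"
    using relators(5)[OF assms]
    by (rule coset_eqI) (use assms in \<open>auto intro!: \<gamma>_closed mero_\<tau> F_gens(1,2)\<close>)
  then show ?thesis using assms F_gens \<gamma>_closed[OF mero_\<tau>(2)[OF assms]]
    by (simp add: \<phi>_def cq_elem_def coset_B \<gamma>_closed)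
qed

text \<open>The relation for \<open>u'\<close> read backwards: apply it to \<open>f\<close> composed
  with \<open>\<tau>\<close> and cancel \<open>\<tau>\<close> against its inverse.\<close>

lemma \<phi>_u':
  assumes "f \<in> mero_rep C" shows "\<phi> f \<otimes>\<^bsub>B\<^esub> u' = u' \<otimes>\<^bsub>B\<^esub> \<phi> (\<lambda>x. f (\<tau> x))"
proof -
  have "\<phi> (\<lambda>x. f (\<tau> (\<tau>' x))) = \<phi> f"
    using assms by (intro \<phi>_cong generic_True irreducible)
      (auto intro: mero_\<tau>(2)[OF mero_\<tau>(1)] simp: \<tau>_inverse simp del: map_prod_simp)
  then show ?thesis using u'_\<phi>[OF mero_\<tau>(1)[OF assms]] by simp
qed

lemma u_u': "u \<otimes>\<^bsub>B\<^esub> u' = \<phi> \<pi>"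
proof -
  have "I +>\<^bsub>F\<^esub> (free_gen W \<otimes>\<^bsub>F\<^esub> free_gen W') = I +>\<^bsub>F\<^esub> \<gamma> \<pi>"
    using relators(6) by (rule coset_eqI) (auto intro!: \<gamma>_closed F_gens(1,2) \<pi>_mero)
  then show ?thesis using F_gens by (simp add: \<phi>_def cq_elem_def coset_B)
qed

lemma u'_u: "u' \<otimes>\<^bsub>B\<^esub> u = \<phi> (\<lambda>x. \<pi> (\<tau>' x))"
proof -
  have "I +>\<^bsub>F\<^esub> (free_gen W' \<otimes>\<^bsub>F\<^esub> free_gen W) = I +>\<^bsub>F\<^esub> \<gamma> (\<lambda>x. \<pi> (\<tau>' x))"
    using relators(7) by (rule coset_eqI) (auto intro!: \<gamma>_closed F_gens(1,2) \<pi>_mero mero_\<tau>)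
  then show ?thesis using F_gens by (simp add: \<phi>_def cq_elem_def coset_B)
qed

section \<open>Normal ordering of products and sums\<close>

text \<open>Functions are moved to the left of \<open>u u\<close> and to the right of
  \<open>u' u'\<close>. Moving \<open>\<phi> r'\<close> left past \<open>u\<close>, or
  \<open>\<phi> s\<close> right past \<open>u'\<close>, composes it with \<open>\<tau>\<close>; in
  the mixed term \<open>s\<close> and \<open>r'\<close> both move left past \<open>u'\<close> and
  are composed with the inverse.\<close>

lemma product_expansion:
  assumes [simp]: "r \<in> mero_rep C" "s \<in> mero_rep C" "r' \<in> mero_rep C" "s' \<in> mero_rep C"
  shows "(\<phi> r \<otimes>\<^bsub>B\<^esub> u \<oplus>\<^bsub>B\<^esub> u' \<otimes>\<^bsub>B\<^esub> \<phi> s) \<otimes>\<^bsub>B\<^esub> (\<phi> r' \<otimes>\<^bsub>B\<^esub> u \<oplus>\<^bsub>B\<^esub> u' \<otimes>\<^bsub>B\<^esub> \<phi> s')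
    = \<phi> (\<lambda>x. r x * r' (\<tau> x)) \<otimes>\<^bsub>B\<^esub> (u \<otimes>\<^bsub>B\<^esub> u)
      \<oplus>\<^bsub>B\<^esub> \<phi> (\<lambda>x. r x * \<pi> x * s' x + s (\<tau>' x) * r' (\<tau>' x) * \<pi> (\<tau>' x))
      \<oplus>\<^bsub>B\<^esub> (u' \<otimes>\<^bsub>B\<^esub> u') \<otimes>\<^bsub>B\<^esub> \<phi> (\<lambda>x. s (\<tau> x) * s' x)"
proof -
  note [simp] = \<pi>_mero mero_\<tau> mero_mult
  have 1: "(\<phi> r \<otimes>\<^bsub>B\<^esub> u) \<otimes>\<^bsub>B\<^esub> (\<phi> r' \<otimes>\<^bsub>B\<^esub> u) = \<phi> (\<lambda>x. r x * r' (\<tau> x)) \<otimes>\<^bsub>B\<^esub> (u \<otimes>\<^bsub>B\<^esub> u)"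
  proof -
    have "(\<phi> r \<otimes>\<^bsub>B\<^esub> u) \<otimes>\<^bsub>B\<^esub> (\<phi> r' \<otimes>\<^bsub>B\<^esub> u) = \<phi> r \<otimes>\<^bsub>B\<^esub> (u \<otimes>\<^bsub>B\<^esub> \<phi> r') \<otimes>\<^bsub>B\<^esub> u"
      by (simp add: B.m_assoc)
    then show ?thesis by (simp add: u_\<phi> \<phi>_mult B.m_assoc)
  qed
  have 2: "(\<phi> r \<otimes>\<^bsub>B\<^esub> u) \<otimes>\<^bsub>B\<^esub> (u' \<otimes>\<^bsub>B\<^esub> \<phi> s') = \<phi> (\<lambda>x. r x * \<pi> x * s' x)"
  proof -
    have "(\<phi> r \<otimes>\<^bsub>B\<^esub> u) \<otimes>\<^bsub>B\<^esub> (u' \<otimes>\<^bsub>B\<^esub> \<phi> s') = \<phi> r \<otimes>\<^bsub>B\<^esub> (u \<otimes>\<^bsub>B\<^esub> u') \<otimes>\<^bsub>B\<^esub> \<phi> s'"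
      by (simp add: B.m_assoc)
    then show ?thesis by (simp add: u_u' \<phi>_mult)
  qed
  have 3: "(u' \<otimes>\<^bsub>B\<^esub> \<phi> s) \<otimes>\<^bsub>B\<^esub> (\<phi> r' \<otimes>\<^bsub>B\<^esub> u) = \<phi> (\<lambda>x. s (\<tau>' x) * r' (\<tau>' x) * \<pi> (\<tau>' x))"
  proof -
    have "(u' \<otimes>\<^bsub>B\<^esub> \<phi> s) \<otimes>\<^bsub>B\<^esub> (\<phi> r' \<otimes>\<^bsub>B\<^esub> u) = (u' \<otimes>\<^bsub>B\<^esub> \<phi> (\<lambda>x. s x * r' x)) \<otimes>\<^bsub>B\<^esub> u"
      by (simp add: \<phi>_mult B.m_assoc)
    also have "\<dots> = \<phi> (\<lambda>x. s (\<tau>' x) * r' (\<tau>' x)) \<otimes>\<^bsub>B\<^esub> (u' \<otimes>\<^bsub>B\<^esub> u)"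
      using mero_\<tau>(2)[of "\<lambda>x. s x * r' x"] by (simp add: u'_\<phi> B.m_assoc)
    also have "\<dots> = \<phi> (\<lambda>x. s (\<tau>' x) * r' (\<tau>' x) * \<pi> (\<tau>' x))"
      unfolding u'_u by (rule \<phi>_mult[symmetric]) simp_all
    finally show ?thesis .
  qed
  have 4: "(u' \<otimes>\<^bsub>B\<^esub> \<phi> s) \<otimes>\<^bsub>B\<^esub> (u' \<otimes>\<^bsub>B\<^esub> \<phi> s') = (u' \<otimes>\<^bsub>B\<^esub> u') \<otimes>\<^bsub>B\<^esub> \<phi> (\<lambda>x. s (\<tau> x) * s' x)"
  proof -
    have "(u' \<otimes>\<^bsub>B\<^esub> \<phi> s) \<otimes>\<^bsub>B\<^esub> (u' \<otimes>\<^bsub>B\<^esub> \<phi> s') = u' \<otimes>\<^bsub>B\<^esub> (\<phi> s \<otimes>\<^bsub>B\<^esub> u') \<otimes>\<^bsub>B\<^esub> \<phi> s'"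
      by (simp add: B.m_assoc)
    then show ?thesis by (simp add: \<phi>_u' \<phi>_mult B.m_assoc)
  qed
  have "\<phi> (\<lambda>x. r x * \<pi> x * s' x + s (\<tau>' x) * r' (\<tau>' x) * \<pi> (\<tau>' x))
    = \<phi> (\<lambda>x. r x * \<pi> x * s' x) \<oplus>\<^bsub>B\<^esub> \<phi> (\<lambda>x. s (\<tau>' x) * r' (\<tau>' x) * \<pi> (\<tau>' x))"
    by (rule \<phi>_add) simp_all
  then show ?thesis
    by (simp add: B.l_distr B.r_distr 1 2 3 4 B.a_ac)
qed

lemma \<phi>_sum:
  assumes "finite P" "\<And>p. p \<in> P \<Longrightarrow> f p \<in> mero_rep C"
  shows "\<phi> (\<lambda>x. \<Sum>p\<in>P. k p * f p x) = (\<Oplus>\<^bsub>B\<^esub>p\<in>P. k p \<odot>\<^bsub>B\<^esub> \<phi> (f p))"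
  using assms
proof (induction P rule: finite_induct)
  case empty
  show ?case using \<phi>_const[of 0] by simp
next
  case (insert p P)
  have "\<phi> (\<lambda>x. k p * f p x + (\<Sum>p\<in>P. k p * f p x)) = \<phi> (\<lambda>x. k p * f p x) \<oplus>\<^bsub>B\<^esub> \<phi> (\<lambda>x. \<Sum>p\<in>P. k p * f p x)"
    using insert by (intro \<phi>_add mero_mult mero_const mero_sum) auto
  then show ?case using insert by (simp add: \<phi>_scale)
qed

text \<open>Gathers the coefficients of a sum of normally ordered terms; \<open>v\<close> and
  \<open>v'\<close> will be \<open>u u\<close> and \<open>u' u'\<close>.\<close>

lemma sum_expansion:
  assumes fin: "finite P" and carr: "v \<in> carrier B" "v' \<in> carrier B"
    and f: "\<And>p. p \<in> P \<Longrightarrow> f p \<in> mero_rep C" and g: "\<And>p. p \<in> P \<Longrightarrow> g p \<in> mero_rep C"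
    and h: "\<And>p. p \<in> P \<Longrightarrow> h p \<in> mero_rep C"
  shows "(\<Oplus>\<^bsub>B\<^esub>p\<in>P. k p \<odot>\<^bsub>B\<^esub> (\<phi> (f p) \<otimes>\<^bsub>B\<^esub> v \<oplus>\<^bsub>B\<^esub> \<phi> (g p) \<oplus>\<^bsub>B\<^esub> v' \<otimes>\<^bsub>B\<^esub> \<phi> (h p)))
    = \<phi> (\<lambda>x. \<Sum>p\<in>P. k p * f p x) \<otimes>\<^bsub>B\<^esub> v \<oplus>\<^bsub>B\<^esub> \<phi> (\<lambda>x. \<Sum>p\<in>P. k p * g p x)
      \<oplus>\<^bsub>B\<^esub> v' \<otimes>\<^bsub>B\<^esub> \<phi> (\<lambda>x. \<Sum>p\<in>P. k p * h p x)"
proof -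
  have "(\<Oplus>\<^bsub>B\<^esub>p\<in>P. k p \<odot>\<^bsub>B\<^esub> (\<phi> (f p) \<otimes>\<^bsub>B\<^esub> v \<oplus>\<^bsub>B\<^esub> \<phi> (g p) \<oplus>\<^bsub>B\<^esub> v' \<otimes>\<^bsub>B\<^esub> \<phi> (h p)))
    = (\<Oplus>\<^bsub>B\<^esub>p\<in>P. (k p \<odot>\<^bsub>B\<^esub> \<phi> (f p)) \<otimes>\<^bsub>B\<^esub> v \<oplus>\<^bsub>B\<^esub> k p \<odot>\<^bsub>B\<^esub> \<phi> (g p) \<oplus>\<^bsub>B\<^esub> v' \<otimes>\<^bsub>B\<^esub> (k p \<odot>\<^bsub>B\<^esub> \<phi> (h p)))"
    using carr f g h
    by (intro B.add.finprod_cong') (auto simp: B.smult_add_right B.smult_mult_left B.smult_mult_right)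
  also have "\<dots> = (\<Oplus>\<^bsub>B\<^esub>p\<in>P. k p \<odot>\<^bsub>B\<^esub> \<phi> (f p)) \<otimes>\<^bsub>B\<^esub> v \<oplus>\<^bsub>B\<^esub> (\<Oplus>\<^bsub>B\<^esub>p\<in>P. k p \<odot>\<^bsub>B\<^esub> \<phi> (g p))
      \<oplus>\<^bsub>B\<^esub> v' \<otimes>\<^bsub>B\<^esub> (\<Oplus>\<^bsub>B\<^esub>p\<in>P. k p \<odot>\<^bsub>B\<^esub> \<phi> (h p))"
    using fin carr f g h
    by (simp add: B.finsum_addf B.finsum_ldistr B.finsum_rdistr Pi_iff)
  finally show ?thesis using fin f g h by (simp add: \<phi>_sum)
qed

lemma linear_expansion:
  assumes fin: "finite P" and carr: "v \<in> carrier B" "v' \<in> carrier B"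
    and f: "\<And>p. p \<in> P \<Longrightarrow> f p \<in> mero_rep C" and h: "\<And>p. p \<in> P \<Longrightarrow> h p \<in> mero_rep C"
  shows "(\<Oplus>\<^bsub>B\<^esub>p\<in>P. k p \<odot>\<^bsub>B\<^esub> (\<phi> (f p) \<otimes>\<^bsub>B\<^esub> v \<oplus>\<^bsub>B\<^esub> v' \<otimes>\<^bsub>B\<^esub> \<phi> (h p)))
    = \<phi> (\<lambda>x. \<Sum>p\<in>P. k p * f p x) \<otimes>\<^bsub>B\<^esub> v \<oplus>\<^bsub>B\<^esub> v' \<otimes>\<^bsub>B\<^esub> \<phi> (\<lambda>x. \<Sum>p\<in>P. k p * h p x)"
proof -
  have "(\<Oplus>\<^bsub>B\<^esub>p\<in>P. k p \<odot>\<^bsub>B\<^esub> (\<phi> (f p) \<otimes>\<^bsub>B\<^esub> v \<oplus>\<^bsub>B\<^esub> v' \<otimes>\<^bsub>B\<^esub> \<phi> (h p)))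
    = (\<Oplus>\<^bsub>B\<^esub>p\<in>P. (k p \<odot>\<^bsub>B\<^esub> \<phi> (f p)) \<otimes>\<^bsub>B\<^esub> v \<oplus>\<^bsub>B\<^esub> v' \<otimes>\<^bsub>B\<^esub> (k p \<odot>\<^bsub>B\<^esub> \<phi> (h p)))"
    using carr f h
    by (intro B.add.finprod_cong') (auto simp: B.smult_add_right B.smult_mult_left B.smult_mult_right)
  also have "\<dots> = (\<Oplus>\<^bsub>B\<^esub>p\<in>P. k p \<odot>\<^bsub>B\<^esub> \<phi> (f p)) \<otimes>\<^bsub>B\<^esub> v
      \<oplus>\<^bsub>B\<^esub> v' \<otimes>\<^bsub>B\<^esub> (\<Oplus>\<^bsub>B\<^esub>p\<in>P. k p \<odot>\<^bsub>B\<^esub> \<phi> (h p))"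
    using fin carr f h
    by (simp add: B.finsum_addf B.finsum_ldistr B.finsum_rdistr Pi_iff)
  finally show ?thesis using fin f h by (simp add: \<phi>_sum)
qed

lemma \<phi>_eq_0: "f \<in> mero_rep C \<Longrightarrow> generic C (\<lambda>x. f x = 0) \<Longrightarrow> \<phi> f = \<zero>\<^bsub>B\<^esub>"
  using \<phi>_cong[OF _ mero_const] \<phi>_const[of 0] by simp

section \<open>The lift of the formula for \<rho> to the tensor algebra\<close>

text \<open>This is \<open>Y(Z)/L(Z)\<close> for the \<open>i\<close>-th basis vector
  \<open>Y\<close>; having degree zero, it may be evaluated at the chosen representative.\<close>

definition r :: "'n \<Rightarrow> 'n proj \<times> 'n proj \<Rightarrow> complex" where
  "r i = (\<lambda>x. rep (fst x) $ i / lin L (rep (fst x)))"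

definition s :: "'n \<Rightarrow> 'n proj \<times> 'n proj \<Rightarrow> complex" where
  "s i = (\<lambda>x. rep (snd x) $ i / lin L' (rep (snd x)))"

lemma r_mero [simp]: "r i \<in> mero_rep C" and s_mero [simp]: "s i \<in> mero_rep C"
proof -
  have "r i = ratio (\<lambda>z z'. z $ i) (\<lambda>z z'. lin L z)" "s i = ratio (\<lambda>z z'. z' $ i) (\<lambda>z z'. lin L' z')"
    by (auto simp: r_def s_def ratio_ev ev_def fun_eq_iff)
  then show "r i \<in> mero_rep C" "s i \<in> mero_rep C"
    by (auto intro!: mero_rep_ratio biform_nth1 biform_nth2 biform_lin1 biform_lin2 lin_nonzero)
qed

lemma ratio_lin:
  "ratio (\<lambda>z z'. lin Y z) (\<lambda>z z'. lin L z) = (\<lambda>x. \<Sum>i\<in>UNIV. Y $ i * r i x)"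
  "ratio (\<lambda>z z'. lin Y z') (\<lambda>z z'. lin L' z') = (\<lambda>x. \<Sum>i\<in>UNIV. Y $ i * s i x)"
  by (auto simp: fun_eq_iff ratio_ev ev_def r_def s_def lin_def sum_divide_distrib)

text \<open>One factor \<open>c\<close> per letter: tensors of degree two acquire
  \<open>c * c\<close>, which is one half.\<close>

definition c :: complex where "c = 1 / complex_of_real (sqrt 2)"

lemma c_simps: "complex_of_real (sqrt 2) * c = 1" "c * complex_of_real (sqrt 2) = 1" "c * c * 2 = 1"
proof -
  have "complex_of_real (sqrt 2) * complex_of_real (sqrt 2) = 2"
    by (metis of_real_mult of_real_numeral real_sqrt_mult_self abs_numeral)
  then show "complex_of_real (sqrt 2) * c = 1" "c * complex_of_real (sqrt 2) = 1" "c * c * 2 = 1"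
    by (auto simp: c_def)
qed

definition y where "y i = c \<odot>\<^bsub>B\<^esub> (\<phi> (r i) \<otimes>\<^bsub>B\<^esub> u \<oplus>\<^bsub>B\<^esub> u' \<otimes>\<^bsub>B\<^esub> \<phi> (s i))"

lemma y_closed [simp]: "y i \<in> carrier B"
  by (simp add: y_def)

lemma lift_tensor1:
  "complex_of_real (sqrt 2) \<odot>\<^bsub>B\<^esub> free_lift B y (tensor1_in Y)
    = \<phi> (\<lambda>x. \<Sum>i\<in>UNIV. Y $ i * r i x) \<otimes>\<^bsub>B\<^esub> u \<oplus>\<^bsub>B\<^esub> u' \<otimes>\<^bsub>B\<^esub> \<phi> (\<lambda>x. \<Sum>i\<in>UNIV. Y $ i * s i x)"
proof -
  have "complex_of_real (sqrt 2) \<odot>\<^bsub>B\<^esub> free_lift B y (tensor1_in Y)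
      = (\<Oplus>\<^bsub>B\<^esub>i\<in>UNIV. complex_of_real (sqrt 2) \<odot>\<^bsub>B\<^esub> (Y $ i \<odot>\<^bsub>B\<^esub> y i))"
    by (simp add: B.free_lift_tensor1 B.smult_finsum)
  also have "\<dots> = (\<Oplus>\<^bsub>B\<^esub>i\<in>UNIV. Y $ i \<odot>\<^bsub>B\<^esub> (\<phi> (r i) \<otimes>\<^bsub>B\<^esub> u \<oplus>\<^bsub>B\<^esub> u' \<otimes>\<^bsub>B\<^esub> \<phi> (s i)))"
  proof (intro B.add.finprod_cong')
    fix i
    have eq: "complex_of_real (sqrt 2) * (Y $ i * c) = Y $ i"
      using c_simps(1) by (simp add: mult.left_commute)
    show "complex_of_real (sqrt 2) \<odot>\<^bsub>B\<^esub> (Y $ i \<odot>\<^bsub>B\<^esub> y i)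
        = Y $ i \<odot>\<^bsub>B\<^esub> (\<phi> (r i) \<otimes>\<^bsub>B\<^esub> u \<oplus>\<^bsub>B\<^esub> u' \<otimes>\<^bsub>B\<^esub> \<phi> (s i))"
      by (simp add: y_def B.smult_smult eq del: mult_cancel_left1)
  qed auto
  also have "\<dots> = \<phi> (\<lambda>x. \<Sum>i\<in>UNIV. Y $ i * r i x) \<otimes>\<^bsub>B\<^esub> u \<oplus>\<^bsub>B\<^esub> u' \<otimes>\<^bsub>B\<^esub> \<phi> (\<lambda>x. \<Sum>i\<in>UNIV. Y $ i * s i x)"
    by (rule linear_expansion) auto
  finally show ?thesis .
qed

text \<open>The coefficients of \<open>W\<^sup>2\<close>, of \<open>1\<close> and of \<open>W'\<^sup>2\<close> in \<open>2\<rho>(\<omega>)\<close>.\<close>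

definition coeff_uu :: "'n tensor2 \<Rightarrow> 'n proj \<times> 'n proj \<Rightarrow> complex" where
  "coeff_uu \<omega> x = (\<Sum>p\<in>UNIV. \<omega> $ p * (r (fst p) x * r (snd p) (\<tau> x)))"

definition coeff_1 :: "'n tensor2 \<Rightarrow> 'n proj \<times> 'n proj \<Rightarrow> complex" where
  "coeff_1 \<omega> x = (\<Sum>p\<in>UNIV. \<omega> $ p *
     (r (fst p) x * \<pi> x * s (snd p) x + s (fst p) (\<tau>' x) * r (snd p) (\<tau>' x) * \<pi> (\<tau>' x)))"

definition coeff_u'u' :: "'n tensor2 \<Rightarrow> 'n proj \<times> 'n proj \<Rightarrow> complex" where
  "coeff_u'u' \<omega> x = (\<Sum>p\<in>UNIV. \<omega> $ p * (s (fst p) (\<tau> x) * s (snd p) x))"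

lemma coeff_mero: "coeff_uu \<omega> \<in> mero_rep C" "coeff_1 \<omega> \<in> mero_rep C" "coeff_u'u' \<omega> \<in> mero_rep C"
  unfolding coeff_uu_def[abs_def] coeff_1_def[abs_def] coeff_u'u'_def[abs_def]
  by (intro mero_sum mero_mult mero_add mero_const mero_\<tau> \<pi>_mero r_mero s_mero)+

text \<open>Bilinearity carries \<open>product_expansion\<close> from pairs of basis vectors to
  arbitrary tensors.\<close>

lemma lift_tensor2:
  "free_lift B y (tensor2_in \<omega>) = (c * c) \<odot>\<^bsub>B\<^esub>
    (\<phi> (coeff_uu \<omega>) \<otimes>\<^bsub>B\<^esub> (u \<otimes>\<^bsub>B\<^esub> u) \<oplus>\<^bsub>B\<^esub> \<phi> (coeff_1 \<omega>) \<oplus>\<^bsub>B\<^esub> (u' \<otimes>\<^bsub>B\<^esub> u') \<otimes>\<^bsub>B\<^esub> \<phi> (coeff_u'u' \<omega>))"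
proof -
  let ?f = "\<lambda>p x. r (fst p) x * r (snd p) (\<tau> x)"
  let ?g = "\<lambda>p x. r (fst p) x * \<pi> x * s (snd p) x + s (fst p) (\<tau>' x) * r (snd p) (\<tau>' x) * \<pi> (\<tau>' x)"
  let ?h = "\<lambda>p x. s (fst p) (\<tau> x) * s (snd p) x"
  have mero: "?f p \<in> mero_rep C" "?g p \<in> mero_rep C" "?h p \<in> mero_rep C" for p
    by (intro mero_mult mero_add mero_\<tau> \<pi>_mero r_mero s_mero)+
  let ?V = "\<lambda>p. \<phi> (?f p) \<otimes>\<^bsub>B\<^esub> (u \<otimes>\<^bsub>B\<^esub> u) \<oplus>\<^bsub>B\<^esub> \<phi> (?g p) \<oplus>\<^bsub>B\<^esub> (u' \<otimes>\<^bsub>B\<^esub> u') \<otimes>\<^bsub>B\<^esub> \<phi> (?h p)"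
  have V: "?V p \<in> carrier B" for p
    using mero[of p] by (intro B.a_closed B.m_closed \<phi>_closed u_closed)
  have yy: "\<omega> $ p \<odot>\<^bsub>B\<^esub> (y (fst p) \<otimes>\<^bsub>B\<^esub> y (snd p)) = (c * c) \<odot>\<^bsub>B\<^esub> (\<omega> $ p \<odot>\<^bsub>B\<^esub> ?V p)" for p
  proof -
    have "y (fst p) \<otimes>\<^bsub>B\<^esub> y (snd p) = (c * c) \<odot>\<^bsub>B\<^esub> ?V p"
      unfolding product_expansion[OF r_mero s_mero r_mero s_mero, symmetric] y_def
      by (simp add: B.smult_mult_left B.smult_mult_right B.smult_smult)
    then show ?thesis using V[of p] by (simp add: B.smult_smult mult.commute)
  qed
  have "free_lift B y (tensor2_in \<omega>) = (\<Oplus>\<^bsub>B\<^esub>p\<in>UNIV. (c * c) \<odot>\<^bsub>B\<^esub> (\<omega> $ p \<odot>\<^bsub>B\<^esub> ?V p))"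
    by (simp only: B.free_lift_tensor2[OF y_closed] yy)
  also have "\<dots> = (c * c) \<odot>\<^bsub>B\<^esub> (\<Oplus>\<^bsub>B\<^esub>p\<in>UNIV. \<omega> $ p \<odot>\<^bsub>B\<^esub> ?V p)"
    by (rule B.smult_finsum[symmetric]) (rule B.smult_closed V)+
  also have "(\<Oplus>\<^bsub>B\<^esub>p\<in>UNIV. \<omega> $ p \<odot>\<^bsub>B\<^esub> ?V p)
    = \<phi> (coeff_uu \<omega>) \<otimes>\<^bsub>B\<^esub> (u \<otimes>\<^bsub>B\<^esub> u) \<oplus>\<^bsub>B\<^esub> \<phi> (coeff_1 \<omega>) \<oplus>\<^bsub>B\<^esub> (u' \<otimes>\<^bsub>B\<^esub> u') \<otimes>\<^bsub>B\<^esub> \<phi> (coeff_u'u' \<omega>)"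
    unfolding coeff_uu_def[abs_def] coeff_1_def[abs_def] coeff_u'u'_def[abs_def]
    by (rule sum_expansion) (simp_all add: mero del: map_prod_simp)
  finally show ?thesis .
qed

section \<open>Evaluation of the three coefficients\<close>

text \<open>Both factors come from \<open>r\<close>, which reads only the first coordinate, so
  \<open>\<omega>\<close> is evaluated at a point of the graph of \<open>\<sigma>\<close>.\<close>

lemma coeff_uu_eq:
  "coeff_uu \<omega> (Z, Z') = bil \<omega> (rep Z) (rep (\<sigma> Z)) / (lin L (rep Z) * lin L (rep (\<sigma> Z)))"
  unfolding coeff_uu_def r_def by (simp only: fst_conv snd_conv map_prod_simp bil_quotient_sum)

lemma coeff_u'u'_eq:
  "coeff_u'u' \<omega> (Z, Z') = bil \<omega> (rep (\<sigma>' Z')) (rep Z') / (lin L' (rep (\<sigma>' Z')) * lin L' (rep Z'))"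
  unfolding coeff_u'u'_def s_def by (simp only: fst_conv snd_conv map_prod_simp bil_quotient_sum)

lemma \<pi>_eq: "\<pi> (Z, Z') = lin L (rep Z) * lin L' (rep Z') / bil Q (rep Z) (rep Z')"
  unfolding cq_pi_def ratio_ev by (simp add: ev_def)

lemma generic_LL': "generic C (\<lambda>x. lin L (rep (fst x)) \<noteq> 0 \<and> lin L' (rep (snd x)) \<noteq> 0
    \<and> bil Q (rep (fst x)) (rep (snd x)) \<noteq> 0)"
proof -
  have "biform 1 1 (\<lambda>z z'. lin L z * lin L' z')"
    using biform_mult[OF biform_lin1[of L] biform_lin2[of L']] by simp
  from generic_conj[OF irreducible generic_biform[OF this LL'_nonzero]
      generic_biform[OF biform_bil Q_nonzero]]
  show ?thesis by (rule generic_mono) (auto simp: ev_def)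
qed

text \<open>The forms \<open>L\<close> and \<open>L'\<close> cancel against those in
  \<open>\<pi>\<close> where they are nonzero; at the twisted point this is generic again by
  pullback. The nonvanishing of \<open>Q\<close> is carried along so that denominators can be
  cleared or cancelled later.\<close>

lemma coeff_1_generic:
  "generic C (\<lambda>x. coeff_1 \<omega> x = bil \<omega> (rep (fst x)) (rep (snd x)) / bil Q (rep (fst x)) (rep (snd x))
     + bil \<omega> (rep (\<sigma> (snd x))) (rep (\<sigma>' (fst x))) / bil Q (rep (\<sigma> (snd x))) (rep (\<sigma>' (fst x)))
     \<and> bil Q (rep (fst x)) (rep (snd x)) \<noteq> 0
     \<and> bil Q (rep (\<sigma> (snd x))) (rep (\<sigma>' (fst x))) \<noteq> 0)"
  using generic_conj[OF irreducible generic_LL' \<tau>'.generic_comp[OF generic_LL']]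
proof (rule generic_mono)
  fix x assume x: "(lin L (rep (fst x)) \<noteq> 0 \<and> lin L' (rep (snd x)) \<noteq> 0
      \<and> bil Q (rep (fst x)) (rep (snd x)) \<noteq> 0) \<and>
    (lin L (rep (fst (\<tau>' x))) \<noteq> 0 \<and> lin L' (rep (snd (\<tau>' x))) \<noteq> 0
      \<and> bil Q (rep (fst (\<tau>' x))) (rep (snd (\<tau>' x))) \<noteq> 0)"
  obtain Z Z' where Z: "x = (Z, Z')" by (cases x)
  note nz = x[unfolded Z, simplified]
  have sum1: "(\<Sum>p\<in>UNIV. \<omega> $ p * (r (fst p) x * s (snd p) x))
      = bil \<omega> (rep Z) (rep Z') / (lin L (rep Z) * lin L' (rep Z'))"
    unfolding r_def s_def Z by (simp only: fst_conv snd_conv map_prod_simp bil_quotient_sum)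
  have sum2: "(\<Sum>p\<in>UNIV. \<omega> $ p * (s (fst p) (\<tau>' x) * r (snd p) (\<tau>' x)))
      = bil \<omega> (rep (\<sigma> Z')) (rep (\<sigma>' Z)) / (lin L' (rep (\<sigma> Z')) * lin L (rep (\<sigma>' Z)))"
    unfolding r_def s_def Z by (simp only: fst_conv snd_conv map_prod_simp bil_quotient_sum)
  have "coeff_1 \<omega> x = (\<Sum>p\<in>UNIV. \<omega> $ p * (r (fst p) x * s (snd p) x)) * \<pi> x
      + (\<Sum>p\<in>UNIV. \<omega> $ p * (s (fst p) (\<tau>' x) * r (snd p) (\<tau>' x))) * \<pi> (\<tau>' x)"
    unfolding coeff_1_def sum_distrib_right sum.distrib[symmetric]
    by (rule sum.cong) (simp_all add: algebra_simps)
  also have "\<dots> = bil \<omega> (rep Z) (rep Z') / bil Q (rep Z) (rep Z')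
      + bil \<omega> (rep (\<sigma> Z')) (rep (\<sigma>' Z)) / bil Q (rep (\<sigma>' Z)) (rep (\<sigma> Z'))"
    unfolding sum1 sum2 using nz by (simp add: Z \<pi>_eq)
  \<comment> \<open>At the twisted point \<open>\<pi>\<close> contains
    \<open>Q(\<sigma>^-1 Z, \<sigma> Z')\<close>; symmetry of \<open>Q\<close> brings the arguments
    into the order of the centrality condition.\<close>
  finally show "coeff_1 \<omega> x = bil \<omega> (rep (fst x)) (rep (snd x)) / bil Q (rep (fst x)) (rep (snd x))
     + bil \<omega> (rep (\<sigma> (snd x))) (rep (\<sigma>' (fst x))) / bil Q (rep (\<sigma> (snd x))) (rep (\<sigma>' (fst x)))
     \<and> bil Q (rep (fst x)) (rep (snd x)) \<noteq> 0
     \<and> bil Q (rep (\<sigma> (snd x))) (rep (\<sigma>' (fst x))) \<noteq> 0"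
    using nz bil_sym[OF symmetric, of "rep (\<sigma> Z')" "rep (\<sigma>' Z)"] by (simp add: Z)
qed

lemma centralD:
  assumes "\<omega> \<in> R" "(Z, Z') \<in> C"
  shows "bil \<omega> (rep Z) (rep Z') * bil Q (rep (\<sigma> Z')) (rep (\<sigma>' Z))
    + bil Q (rep Z) (rep Z') * bil \<omega> (rep (\<sigma> Z')) (rep (\<sigma>' Z)) = 0"
  using central assms rep_in_reps unfolding central_on_def by fast

text \<open>Both directions matter: one makes each \<open>\<omega>\<close> in \<open>R\<close>
  vanish on the graph, the other recognises a point of the graph from the vanishing of all of
  \<open>R\<close>.\<close>

lemma graph_iff:
  assumes "Z \<in> E" shows "Z' = \<sigma> Z \<longleftrightarrow> (\<forall>\<omega>\<in>R. bil \<omega> (rep Z) (rep Z') = 0)"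
proof -
  have "(Z, Z') \<in> \<Gamma> R \<longleftrightarrow> (\<forall>\<omega>\<in>R. bil \<omega> (rep Z) (rep Z') = 0)"
    by (simp add: \<Gamma>_def vanishes_on_biform[OF biform_bil] ev_def)
  moreover have "\<Gamma> R = (\<lambda>Z. (Z, \<sigma> Z)) ` E"
    using char by (simp add: characteristic_variety_def)
  ultimately show ?thesis using assms by auto
qed

text \<open>The outer coefficients vanish at every point of \<open>C\<close>; the middle one is
  shown to vanish where both values of \<open>Q\<close> are nonzero, which determines its
  class.\<close>

lemma lift_relation:
  assumes \<omega>: "\<omega> \<in> R" shows "free_lift B y (tensor2_in \<omega>) = \<zero>\<^bsub>B\<^esub>"
proof -
  have "generic C (\<lambda>x. coeff_uu \<omega> x = 0)"
  proof (rule generic_True[OF irreducible])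
    fix x assume "x \<in> C"
    then obtain Z Z' where "x = (Z, Z')" "Z \<in> E" using C_subset by auto
    then show "coeff_uu \<omega> x = 0" using graph_iff[of Z "\<sigma> Z"] \<omega> by (simp add: coeff_uu_eq)
  qed
  then have 1: "\<phi> (coeff_uu \<omega>) = \<zero>\<^bsub>B\<^esub>" by (rule \<phi>_eq_0[OF coeff_mero(1)])
  have "generic C (\<lambda>x. coeff_u'u' \<omega> x = 0)"
  proof (rule generic_True[OF irreducible])
    fix x assume "x \<in> C"
    then obtain Z Z' where "x = (Z, Z')" "Z' \<in> E" using C_subset by auto
    then show "coeff_u'u' \<omega> x = 0"
      using graph_iff[of "\<sigma>' Z'" Z'] \<omega> by (simp add: coeff_u'u'_eq \<sigma>_closed \<sigma>_inverse)
  qed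
  then have 2: "\<phi> (coeff_u'u' \<omega>) = \<zero>\<^bsub>B\<^esub>" by (rule \<phi>_eq_0[OF coeff_mero(3)])
  have "generic C (\<lambda>x. coeff_1 \<omega> x = 0)"
    using coeff_1_generic[of \<omega>]
  proof (rule generic_mono)
    fix x assume x: "x \<in> C" and nz: "coeff_1 \<omega> x = bil \<omega> (rep (fst x)) (rep (snd x)) / bil Q (rep (fst x)) (rep (snd x))
     + bil \<omega> (rep (\<sigma> (snd x))) (rep (\<sigma>' (fst x))) / bil Q (rep (\<sigma> (snd x))) (rep (\<sigma>' (fst x)))
     \<and> bil Q (rep (fst x)) (rep (snd x)) \<noteq> 0
     \<and> bil Q (rep (\<sigma> (snd x))) (rep (\<sigma>' (fst x))) \<noteq> 0"
    \<comment> \<open>Centrality is this sum of fractions with the denominators cleared.\<close>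
    have "a / q + b / q' = 0" if "a * q' + q * b = 0" "q \<noteq> 0" "q' \<noteq> 0" for a b q q' :: complex
      using that by (simp add: field_simps)
    with nz centralD[OF \<omega>, of "fst x" "snd x"] x show "coeff_1 \<omega> x = 0" by auto
  qed
  then have 3: "\<phi> (coeff_1 \<omega>) = \<zero>\<^bsub>B\<^esub>" by (rule \<phi>_eq_0[OF coeff_mero(2)])
  show ?thesis by (simp add: lift_tensor2 1 2 3)
qed

section \<open>The image of \<open>Q\<close>\<close>

text \<open>The first form compares the two entries of \<open>\<tau> (\<tau> (Z, Z))\<close>, which
  makes the condition a pullback of the diagonal; the second is the form reached from centrality on
  the graph.\<close>

lemma \<sigma>4_iff:
  assumes "Z \<in> E" shows "(\<sigma> ^^ 4) Z = Z \<longleftrightarrow> \<sigma> (\<sigma> Z) = \<sigma>' (\<sigma>' Z)"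
    and "(\<sigma> ^^ 4) Z = Z \<longleftrightarrow> \<sigma> (\<sigma> (\<sigma> Z)) = \<sigma>' Z"
proof -
  have eq: "(\<sigma> ^^ 4) Z = \<sigma> (\<sigma> (\<sigma> (\<sigma> Z)))" by (simp add: numeral_eq_Suc)
  show "(\<sigma> ^^ 4) Z = Z \<longleftrightarrow> \<sigma> (\<sigma> Z) = \<sigma>' (\<sigma>' Z)"
    unfolding eq using assms \<sigma>_closed \<sigma>_inverse by metis
  show "(\<sigma> ^^ 4) Z = Z \<longleftrightarrow> \<sigma> (\<sigma> (\<sigma> Z)) = \<sigma>' Z"
    unfolding eq using assms \<sigma>_closed \<sigma>_inverse by metis
qed

text \<open>Centrality at \<open>(Z, \<sigma>(Z))\<close>, where every \<open>\<omega>\<close> in \<open>R\<close> vanishes, puts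
  \<open>(\<sigma>\<^sup>2(Z), \<sigma>\<^sup>-\<^sup>1(Z))\<close> on the graph of \<open>\<sigma>\<close> as soon as \<open>Q(Z, \<sigma>(Z)) \<noteq> 0\<close>.\<close>

lemma Q_graph_eq_0:
  assumes C: "(Z, \<sigma> Z) \<in> C" and nontrivial: "(\<sigma> ^^ 4) Z \<noteq> Z"
  shows "bil Q (rep Z) (rep (\<sigma> Z)) = 0"
proof (rule ccontr)
  assume nz: "bil Q (rep Z) (rep (\<sigma> Z)) \<noteq> 0"
  have Z: "Z \<in> E" using C C_subset by auto
  have "bil \<omega> (rep (\<sigma> (\<sigma> Z))) (rep (\<sigma>' Z)) = 0" if "\<omega> \<in> R" for \<omega>
    using centralD[OF that C] graph_iff[OF Z, of "\<sigma> Z"] that nz by simp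
  then have "\<sigma>' Z = \<sigma> (\<sigma> (\<sigma> Z))" using Z by (subst graph_iff) (auto intro: \<sigma>_closed)
  then show False using nontrivial \<sigma>4_iff(2)[OF Z] by simp
qed

text \<open>With \<open>C = K \<times> K\<close> the diagonal point \<open>(Z0, Z0)\<close> and all
  graph points \<open>(Z, \<sigma> Z)\<close> with \<open>Z\<close> in \<open>K\<close> lie on
  \<open>C\<close>: openness is tested at the former, centrality is applied at the latter.\<close>

lemma lift_Q:
  assumes K: "C = K \<times> K" and Z0: "Z0 \<in> K" "(\<sigma> ^^ 4) Z0 \<noteq> Z0"
  shows "free_lift B y (tensor2_in Q) = \<one>\<^bsub>B\<^esub>"
proof -
  have \<sigma>K: "\<sigma> Z \<in> K" "\<sigma>' Z \<in> K" if "Z \<in> K" for Z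
  proof -
    have "\<tau> (Z, Z) \<in> C" using that \<tau>_image(1) K by blast
    then show "\<sigma> Z \<in> K" "\<sigma>' Z \<in> K" using K by auto
  qed
  have KE: "K \<subseteq> E" using C_subset K by auto
  let ?P = "\<lambda>x. \<sigma> (\<sigma> (fst x)) \<noteq> \<sigma>' (\<sigma>' (snd x))"
  have "near C (Z0, Z0) ?P"
  proof -
    have mem: "(Z0, Z0) \<in> C" "\<tau> (Z0, Z0) \<in> C" "\<tau> (\<tau> (Z0, Z0)) \<in> C"
      using Z0 \<sigma>K by (simp_all add: K)
    \<comment> \<open>This point is off the diagonal because \<open>\<sigma>^4\<close> moves
      \<open>Z0\<close>; two pullbacks carry the open condition back to
      \<open>(Z0, Z0)\<close>.\<close>
    have "near C (\<tau> (\<tau> (Z0, Z0))) (\<lambda>x. fst x \<noteq> snd x)"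
      using Z0 \<sigma>4_iff(1)[of Z0] KE by (intro near_distinct mem) auto
    then have "near C (\<tau> (Z0, Z0)) (\<lambda>x. fst (\<tau> x) \<noteq> snd (\<tau> x))"
      by (rule \<tau>.near_comp[OF mem(2)])
    then have "near C (Z0, Z0) (\<lambda>x. fst (\<tau> (\<tau> x)) \<noteq> snd (\<tau> (\<tau> x)))"
      by (rule \<tau>.near_comp[OF mem(1)])
    then show ?thesis by (rule near_mono) auto
  qed
  then obtain d e q where q: "biform d e q" "ev q (Z0, Z0) \<noteq> 0"
    and P: "\<forall>x\<in>C. ev q x \<noteq> 0 \<longrightarrow> ?P x"
    by (rule nearE)
  have nontrivial: "(\<sigma> ^^ 4) Z \<noteq> Z" if "Z \<in> K" "q (rep Z) (rep Z) \<noteq> 0" for Z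
  proof -
    have "?P (Z, Z)" using P that K by (auto simp: ev_def)
    then show ?thesis using \<sigma>4_iff(1)[of Z] that KE by auto
  qed
  have Z0C: "(Z0, Z0) \<in> C" using Z0 K by simp
  \<comment> \<open>\<open>q z z\<close> is nonzero at \<open>Z0\<close>, depends on
    \<open>Z\<close> alone, and its nonvanishing forces \<open>\<sigma>^4\<close> to move
    \<open>Z\<close>.\<close>
  have "near C (Z0, Z0) (\<lambda>x. ev (\<lambda>z z'. q z z) x \<noteq> 0)"
    using q by (intro near_biform[OF biform_diag[OF q(1)] Z0C]) (simp add: ev_def)
  then have gen1: "generic C (\<lambda>x. ev (\<lambda>z z'. q z z) x \<noteq> 0)"
    unfolding generic_def by (rule exI)
  \<comment> \<open>The same form in the second coordinate, on which the coefficient of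
    \<open>u' u'\<close> depends.\<close>
  have "near C (Z0, Z0) (\<lambda>x. ev (\<lambda>z z'. q z' z') x \<noteq> 0)"
    using q by (intro near_biform[OF biform_swap[OF biform_diag[OF q(1)]] Z0C]) (simp add: ev_def)
  then have gen2: "generic C (\<lambda>x. ev (\<lambda>z z'. q z' z') x \<noteq> 0)"
    unfolding generic_def by (rule exI)
  have "generic C (\<lambda>x. coeff_uu Q x = 0)"
    using gen1
  proof (rule generic_mono)
    fix x assume x: "x \<in> C" "ev (\<lambda>z z'. q z z) x \<noteq> 0"
    obtain Z Z' where Z: "x = (Z, Z')" by (cases x)
    then have "Z \<in> K" "(\<sigma> ^^ 4) Z \<noteq> Z" using x nontrivial[of Z] K by (auto simp: ev_def)
    then have "bil Q (rep Z) (rep (\<sigma> Z)) = 0" using \<sigma>K K by (intro Q_graph_eq_0) auto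
    then show "coeff_uu Q x = 0" by (simp add: Z coeff_uu_eq)
  qed
  then have 1: "\<phi> (coeff_uu Q) = \<zero>\<^bsub>B\<^esub>" by (rule \<phi>_eq_0[OF coeff_mero(1)])
  have "generic C (\<lambda>x. coeff_u'u' Q x = 0)"
    using gen2
  proof (rule generic_mono)
    fix x assume x: "x \<in> C" "ev (\<lambda>z z'. q z' z') x \<noteq> 0"
    obtain Z Z' where Z: "x = (Z, Z')" by (cases x)
    then have Z': "Z' \<in> K" "(\<sigma> ^^ 4) Z' \<noteq> Z'" using x nontrivial[of Z'] K by (auto simp: ev_def)
    have inv: "\<sigma> (\<sigma>' Z') = Z'" using Z' KE \<sigma>_inverse by auto
    \<comment> \<open>Applying \<open>\<sigma>\<close> to a fixed point of \<open>\<sigma>^4\<close>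
      gives another one, so a fixed \<open>\<sigma>' Z'\<close> would make \<open>Z'\<close>
      fixed.\<close>
    have "(\<sigma> ^^ 4) (\<sigma>' Z') \<noteq> \<sigma>' Z'"
    proof
      assume "(\<sigma> ^^ 4) (\<sigma>' Z') = \<sigma>' Z'"
      then have "\<sigma> ((\<sigma> ^^ 4) (\<sigma>' Z')) = Z'" using inv by simp
      moreover have "\<sigma> ((\<sigma> ^^ 4) (\<sigma>' Z')) = (\<sigma> ^^ 4) Z'"
        by (simp add: numeral_eq_Suc inv)
      ultimately show False using Z' by simp
    qed
    then have "bil Q (rep (\<sigma>' Z')) (rep Z') = 0"
      using Q_graph_eq_0[of "\<sigma>' Z'"] \<sigma>K Z' K inv by auto
    then show "coeff_u'u' Q x = 0" by (simp add: Z coeff_u'u'_eq)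
  qed
  then have 2: "\<phi> (coeff_u'u' Q) = \<zero>\<^bsub>B\<^esub>" by (rule \<phi>_eq_0[OF coeff_mero(3)])
  \<comment> \<open>Both fractions are \<open>Q\<close> over \<open>Q\<close>; their sum
    \<open>2\<close> is cancelled by the factor \<open>c * c\<close>.\<close>
  have "generic C (\<lambda>x. coeff_1 Q x = 2)"
    using coeff_1_generic[of Q] by (rule generic_mono) auto
  then have 3: "\<phi> (coeff_1 Q) = 2 \<odot>\<^bsub>B\<^esub> \<one>\<^bsub>B\<^esub>"
    using \<phi>_cong[OF coeff_mero(2) mero_const] \<phi>_const[of 2] by simp
  show ?thesis
    by (simp add: lift_tensor2 1 2 3 B.smult_smult c_simps)
qed

section \<open>Existence, uniqueness and evaluation of \<rho>\<close>

lemma quadratic_class_hom: "quadratic_class R \<in> algebra_hom tensor_algebra (quadratic_algebra R)"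
  unfolding quadratic_algebra_def quadratic_ideal_def quadratic_class_def[abs_def]
  by (intro algebra_ideal.coset_hom algebra_ideal.intro free_algebra_complex_algebra
      ring.genideal_ideal complex_algebra.axioms(1)) (auto simp: tensor2_closed)

lemma carrier_quadratic: "carrier (quadratic_algebra R) = quadratic_class R ` carrier tensor_algebra"
  unfolding quadratic_algebra_def carrier_quot_algebra quadratic_class_def[abs_def] ..

lemma rho_formula_eq:
  "rho_formula R E \<sigma> C Q L L' \<rho> \<longleftrightarrow> (\<forall>Y. complex_of_real (sqrt 2) \<odot>\<^bsub>B\<^esub> \<rho> (quadratic_class R (tensor1_in Y))
    = \<phi> (\<lambda>x. \<Sum>i\<in>UNIV. Y $ i * r i x) \<otimes>\<^bsub>B\<^esub> u \<oplus>\<^bsub>B\<^esub> u' \<otimes>\<^bsub>B\<^esub> \<phi> (\<lambda>x. \<Sum>i\<in>UNIV. Y $ i * s i x))"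
  by (simp add: rho_formula_def Let_def ratio_lin \<phi>_def)

text \<open>Both sides are homomorphisms on the tensor algebra, so basis vectors suffice; there the
  formula determines the value after multiplication by \<open>c\<close>. This gives uniqueness and
  lets any such \<rho> be computed through the lift.\<close>

lemma rho_eq_lift:
  assumes \<rho>: "\<rho> \<in> algebra_hom (quadratic_algebra R) B" "rho_formula R E \<sigma> C Q L L' \<rho>"
    and t: "t \<in> carrier tensor_algebra"
  shows "\<rho> (quadratic_class R t) = free_lift B y t"
proof -
  have "(\<rho> \<circ> quadratic_class R) t = free_lift B y t"
  proof (rule free_algebra_hom_eq[OF B_algebra algebra_hom_comp[OF quadratic_class_hom \<rho>(1)] _ _ t])
    show "free_lift B y \<in> algebra_hom tensor_algebra B" by (rule B.free_lift_hom) simp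
  next
    fix i :: 'n
    let ?a = "\<rho> (quadratic_class R (free_gen i))" and ?b = "free_lift B y (free_gen i)"
    have gen: "free_gen i \<in> carrier tensor_algebra"
      using tensor1_closed[of "axis i 1"] by (simp add: tensor1_axis)
    have closed: "?a \<in> carrier B" "?b \<in> carrier B"
      using gen algebra_homD(1)[OF \<rho>(1)] algebra_homD(1)[OF quadratic_class_hom]
        B.free_lift_closed[of UNIV y] by auto
    have "complex_of_real (sqrt 2) \<odot>\<^bsub>B\<^esub> ?a = complex_of_real (sqrt 2) \<odot>\<^bsub>B\<^esub> ?b"
      using \<rho>(2) lift_tensor1[of "axis i 1"] unfolding rho_formula_eq tensor1_axis[symmetric] by simp
    then have "c \<odot>\<^bsub>B\<^esub> (complex_of_real (sqrt 2) \<odot>\<^bsub>B\<^esub> ?a) = c \<odot>\<^bsub>B\<^esub> (complex_of_real (sqrt 2) \<odot>\<^bsub>B\<^esub> ?b)"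
      by simp
    then show "(\<rho> \<circ> quadratic_class R) (free_gen i) = ?b"
      using closed by (simp add: B.smult_smult c_simps)
  qed
  then show ?thesis by simp
qed

text \<open>The lift kills the generators of the quadratic ideal by \<open>lift_relation\<close>,
  hence factors through the quotient.\<close>

lemma rho_exists:
  obtains \<rho> where "\<rho> \<in> algebra_hom (quadratic_algebra R) B"
    "\<rho> \<in> extensional (carrier (quadratic_algebra R))" "rho_formula R E \<sigma> C Q L L' \<rho>"
proof -
  have hom: "free_lift B y \<in> algebra_hom tensor_algebra B" by (rule B.free_lift_hom) simp
  have sub: "tensor2_in ` R \<subseteq> carrier tensor_algebra" using tensor2_closed by auto
  have zero: "free_lift B y t = \<zero>\<^bsub>B\<^esub>" if "t \<in> tensor2_in ` R" for t
    using that lift_relation by auto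
  obtain \<rho> where \<rho>: "\<rho> \<in> algebra_hom (quadratic_algebra R) B"
    "\<rho> \<in> extensional (carrier (quadratic_algebra R))"
    "\<forall>t\<in>carrier tensor_algebra. \<rho> (quadratic_class R t) = free_lift B y t"
    using factor_algebra_hom[OF free_algebra_complex_algebra B_algebra hom sub zero]
    unfolding quadratic_algebra_def quadratic_ideal_def quadratic_class_def by metis
  have "rho_formula R E \<sigma> C Q L L' \<rho>"
    unfolding rho_formula_eq by (simp only: bspec[OF \<rho>(3) tensor1_closed] lift_tensor1) simp
  with \<rho>(1,2) show ?thesis by (rule that)
qed

text \<open>As functions, homomorphisms are unconstrained outside the carrier;
  \<open>extensional\<close> fixes those values, so agreement on cosets becomes equality.\<close>

lemma rho_ex1:
  "\<exists>!\<rho>. \<rho> \<in> algebra_hom (quadratic_algebra R) B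
    \<and> \<rho> \<in> extensional (carrier (quadratic_algebra R)) \<and> rho_formula R E \<sigma> C Q L L' \<rho>"
proof (rule ex_ex1I)
  show "\<exists>\<rho>. \<rho> \<in> algebra_hom (quadratic_algebra R) B
    \<and> \<rho> \<in> extensional (carrier (quadratic_algebra R)) \<and> rho_formula R E \<sigma> C Q L L' \<rho>"
    using rho_exists by metis
next
  fix \<rho>1 \<rho>2
  assume 1: "\<rho>1 \<in> algebra_hom (quadratic_algebra R) B \<and>
      \<rho>1 \<in> extensional (carrier (quadratic_algebra R)) \<and> rho_formula R E \<sigma> C Q L L' \<rho>1"
    and 2: "\<rho>2 \<in> algebra_hom (quadratic_algebra R) B \<and>
      \<rho>2 \<in> extensional (carrier (quadratic_algebra R)) \<and> rho_formula R E \<sigma> C Q L L' \<rho>2"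
  show "\<rho>1 = \<rho>2"
  proof (rule extensionalityI)
    fix X assume "X \<in> carrier (quadratic_algebra R)"
    then obtain t where t: "t \<in> carrier tensor_algebra" and X: "X = quadratic_class R t"
      unfolding carrier_quadratic by blast
    show "\<rho>1 X = \<rho>2 X"
      unfolding X using rho_eq_lift[of \<rho>1, OF _ _ t] rho_eq_lift[of \<rho>2, OF _ _ t] 1 2 by auto
  qed (use 1 2 in auto)
qed

lemma rho_Q:
  assumes "\<rho> \<in> algebra_hom (quadratic_algebra R) B" "rho_formula R E \<sigma> C Q L L' \<rho>"
    and "C = K \<times> K" "\<exists>Z\<in>K. (\<sigma> ^^ 4) Z \<noteq> Z"
  shows "\<rho> (quadratic_class R (tensor2_in Q)) = \<one>\<^bsub>B\<^esub>"
  using assms lift_Q rho_eq_lift[OF assms(1,2) tensor2_closed] by auto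

end

theorem lemma11p2:
  fixes R :: "(complex ^ ('n::finite \<times> 'n)) set"
    and E :: "'n proj set"
    and \<sigma> :: "'n proj \<Rightarrow> 'n proj"
    and C :: "('n proj \<times> 'n proj) set"
    and Q :: "complex ^ ('n \<times> 'n)"
    and L L' :: "complex ^ 'n"
  assumes "vec.subspace R"
    and "characteristic_variety R E \<sigma>"
    and "component_of (E \<times> E) C"
    and "twist E \<sigma> ` C = C"
    and "symmetric_tensor Q"
    and "central_on R E \<sigma> C Q"
    and "\<not> vanishes_on C (bil Q)"
    and "\<not> vanishes_on C (\<lambda>z z'. lin L z * lin L' z')"
  shows "(\<exists>!\<rho>. \<rho> \<in> algebra_hom (quadratic_algebra R) (CQ E \<sigma> C Q L L')
              \<and> \<rho> \<in> extensional (carrier (quadratic_algebra R))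
              \<and> rho_formula R E \<sigma> C Q L L' \<rho>)
       \<and> (\<forall>\<rho> K. \<rho> \<in> algebra_hom (quadratic_algebra R) (CQ E \<sigma> C Q L L')
              \<longrightarrow> rho_formula R E \<sigma> C Q L L' \<rho>
              \<longrightarrow> C = K \<times> K \<longrightarrow> (\<exists>Z\<in>K. (\<sigma> ^^ 4) Z \<noteq> Z)
              \<longrightarrow> \<rho> (quadratic_class R (tensor2_in Q)) = \<one>\<^bsub>CQ E \<sigma> C Q L L'\<^esub>)"
proof -
  interpret central_component R E \<sigma> C Q L L'
    using assms by unfold_locales
  show ?thesis
    using rho_ex1 rho_Q by blast
qed

end
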